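(* Let $X=(V,E,\mathrm{rt},V_\bullet)$ be a $2$-colored rooted tree with $\mathrm{rt}\in V_\bullet$ and let $\boldsymbol{k}=(k_e)_{e\in E}$ be an essentially positive index on $X$. Then in $\mathfrak{H}^1[[t]]$, $$\widehat{\phi}\bigl(w(X_{\mathrm h},\boldsymbol{k}_{\mathrm h})\bigr)=\sum_{v\in V_\bullet}(-1)^{k_{P(\mathrm{rt},v)}}\sum_{\boldsymbol{l}\in\mathbb{Z}_{\ge0}^{P(\mathrm{rt},v)}} b_{P(\mathrm{rt},v)}\binom{\boldsymbol{k}}{\boldsymbol{l}}\; w\bigl(X_{v,\mathrm h},(\boldsymbol{k}+\boldsymbol{l})_{\mathrm h}\bigr)\,t^{l_{P(\mathrm{rt},v)}},$$ where $X_v:=(V,E,v,V_\bullet)$ and $\boldsymbol{k}+\boldsymbol{l}$ is the index on $X_v$ given by $k_e+l_e$ for $e\in P(\mathrm{rt},v)$ and $k_e$ otherwise. In particular (taking constant terms in $t$), $$\phi\bigl(w(X_{\mathrm h},\boldsymbol{k}_{\mathrm h})\bigr)=\sum_{v\in V_\bullet}(-1)^{k_{P(\mathrm{rt},v)}}\,w(X_{v,\mathrm h},\boldsymbol{k}_{\mathrm h}).$$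
   Context: Algebraic setup. $\mathfrak{H}=\mathbb{Q}\langle x,y\rangle$ is the noncommutative polynomial ring, $\mathfrak{H}^1=\mathbb{Q}+y\mathfrak{H}$, $z_k=yx^{k-1}$ for $k\ge1$. For an index (tuple of positive integers) $\boldsymbol{k}=(k_1,\dots,k_r)$, $z_{\boldsymbol{k}}=z_{k_1}\cdots z_{k_r}$ and $z_\varnothing=1$. The shuffle product $ш$ on $\mathfrak{H}$ is the $\mathbb{Q}$-bilinear map with $a\,ш\,1=1\,ш\,a=a$ and $(a_1u_1)ш(a_2u_2)=(a_1ш a_2u_2)u_1+(a_1u_1ш a_2)u_2$ for $a_1,a_2\in\mathfrak{H}$, $u_1,u_2\in\{x,y\}$; it is extended $\mathbb{Q}[[t]]$-bilinearly. For tuples $\boldsymbol{k}=(k_1,\dots,k_r)$, $\boldsymbol{l}=(l_1,\dots,l_r)$ of nonnegative integers: $\mathrm{wt}(\boldsymbol{k})=k_1+\dots+k_r$, $\overline{\boldsymbol{k}}=(k_r,\dots,k_1)$, $\boldsymbol{k}+\boldsymbol{l}=(k_1+l_1,\dots,k_r+l_r)$, $b\binom{\boldsymbol{k}}{\boldsymbol{l}}=\prod_{i=1}^r\binom{k_i+l_i-1}{l_i}$ with the convention $\binom{l-1}{l}=\delta_{l,0}$, $\boldsymbol{k}_{[i]}=(k_1,\dots,k_i)$, $\boldsymbol{k}^{[i]}=(k_{i+1},\dots,k_r)$. The $t$-adic symmetrization map is the $\mathbb{Q}[[t]]$-linear map $\widehat{\phi}:\mathfrak{H}^1[[t]]\to\mathfrak{H}^1[[t]]$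 given on an index $\boldsymbol{k}$ of depth $r$ by $$\widehat{\phi}(z_{\boldsymbol{k}})=\sum_{i=0}^r(-1)^{\mathrm{wt}(\boldsymbol{k}^{[i]})}z_{\boldsymbol{k}_{[i]}}\,ш\sum_{\boldsymbol{l}\in\mathbb{Z}_{\ge0}^{r-i}}b\binom{\boldsymbol{k}^{[i]}}{\boldsymbol{l}}z_{\overline{\boldsymbol{k}^{[i]}+\boldsymbol{l}}}\,t^{\mathrm{wt}(\boldsymbol{l})},$$ and $\phi=\widehat{\phi}|_{\mathfrak{H}^1}$ followed by setting $t=0$ (i.e. the constant term). For $M\ge0$, $Z_M:\mathfrak{H}^1\to\mathbb{Q}$ is the $\mathbb{Q}$-linear map with $Z_M(z_{\boldsymbol{k}})=\sum_{0<n_1<\dots<n_r<M}n_1^{-k_1}\cdots n_r^{-k_r}$ (empty sum $=0$, $Z_M(1)=1$). Trees. A $2$-colored rooted tree is $X=(V,E,\mathrm{rt},V_\bullet)$ where $(V,E)$ is a finite tree, $\mathrm{rt}\in V$ (the root), and $V_\bullet\subset V$ contains all vertices of degree $1$. Trees are non-planar (no ordering of children). An index on $X$ is $\boldsymbol{k}=(k_e)_{e\in E}\in\mathbb{Z}_{\ge0}^E$. $P(v,v')$ denotes the set of edges on the path from $v$ to $v'$; for $E'\subset E$, $k_{E'}=\sum_{e\in E'}k_e$; for $E_0\subset E$ and families $\boldsymbol{k},\boldsymbol{l}$ defined on $E_0$, $b_{E_0}\binom{\boldsymbol{k}}{\boldsymbol{l}}=\prod_{e\in E_0}\binom{k_e+l_e-1}{l_e}$.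 $\boldsymbol{k}$ is essentially positive if $k_{P(v,v')}>0$ for all distinct $v,v'\in V_\bullet$. For $\mathrm{rt}\in V_\bullet$, $$\zeta_M(X;\boldsymbol{k})=\sum_{\substack{(m_v)\in\mathbb{Z}_{\ge1}^{V_\bullet}\\ \sum_v m_v=M}}\prod_{e\in E}\Bigl(\sum_{v\in V_\bullet,\ e\in P(\mathrm{rt},v)}m_v\Bigr)^{-k_e}.$$ The element $w(X_{\mathrm h},\boldsymbol{k}_{\mathrm h})$. For such $(X,\boldsymbol{k})$ with $\mathrm{rt}\in V_\bullet$ and $\boldsymbol{k}$ essentially positive, $(X_{\mathrm h},\boldsymbol{k}_{\mathrm h})$ is its "harvestable form" (obtained by contracting edges, joining edges and inserting white vertices), and $w(X_{\mathrm h},\boldsymbol{k}_{\mathrm h})\in\mathfrak{H}^1$ is the associated word. For the purposes of this statement it is characterized as the unique element $w\in\mathfrak{H}^1$ such that $Z_M(w)=\zeta_M(X;\boldsymbol{k})$ for all $M\ge0$ (such an element exists, and it is unique because the family $(Z_M)_{M\ge0}$ separates elements of $\mathfrak{H}^1$). For example, if $X$ is the linear tree with vertices $v_1,\dots,v_{r+1}$, edges $e_a=\{v_a,v_{a+1}\}$, all vertices black and root $v_{r+1}$, then $w(X_{\mathrm h},\boldsymbol{k}_{\mathrm h})=z_{k_{e_1}}\cdots z_{k_{e_r}}$ when all $k_{e_a}>0$.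
   Formalization: The element w is characterized by Z_M(w)=ζ_M(X;k) for all M≥1 instead of M≥0, since for the one-vertex tree no w satisfies the M=0 condition (ζ_0=0, ζ_1=1, but Z_0(w)=Z_1(w)); for all other trees the two characterizations agree. *)

theory Defs
  imports Complex_Main "HOL-Library.Multiset"
begin

datatype letter = LX | LY

text \<open>An element of H is a finitely supported function from words to rat
  (coefficient of each word). An element of H[[t]] is a function
  nat => word => rat giving the coefficient of t^n.\<close>

definition supp :: "(letter list \<Rightarrow> rat) \<Rightarrow> letter list set" where
  "supp p = {u. p u \<noteq> 0}"

definition in_H1 :: "(letter list \<Rightarrow> rat) \<Rightarrow> bool" where
  "in_H1 p \<longleftrightarrow> finite (supp p) \<and> (\<forall>u. p u \<noteq> 0 \<longrightarrow> u = [] \<or> hd u = LY)"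

text \<open>Shuffle of words (with multiplicities), following the recursion on the
  last letters: (a1 u1) sh (a2 u2) = (a1 sh a2 u2) u1 + (a1 u1 sh a2) u2.
  shuf_rev works on reversed words.\<close>

fun shuf_rev :: "letter list \<Rightarrow> letter list \<Rightarrow> letter list multiset" where
  "shuf_rev [] v = {#v#}"
| "shuf_rev u [] = {#u#}"
| "shuf_rev (u1 # a1) (u2 # a2) =
     image_mset (Cons u1) (shuf_rev a1 (u2 # a2)) + image_mset (Cons u2) (shuf_rev (u1 # a1) a2)"

definition shuf :: "letter list \<Rightarrow> letter list \<Rightarrow> letter list multiset" where
  "shuf u v = image_mset rev (shuf_rev (rev u) (rev v))"

definition zk :: "nat \<Rightarrow> letter list" where
  "zk k = LY # replicate (k - 1) LX"

definition zw :: "nat list \<Rightarrow> letter list" where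
  "zw ks = concat (map zk ks)"

definition pos_idx :: "nat list \<Rightarrow> bool" where
  "pos_idx ks \<longleftrightarrow> (\<forall>k\<in>set ks. 0 < k)"

text \<open>binomial(k+l-1, l) with the convention binomial(l-1,l) = delta_(l,0).\<close>

definition bin :: "nat \<Rightarrow> nat \<Rightarrow> nat" where
  "bin k l = (if k = 0 then (if l = 0 then 1 else 0) else (k + l - 1) choose l)"

definition bprod :: "nat list \<Rightarrow> nat list \<Rightarrow> nat" where
  "bprod ks ls = prod_list (map2 bin ks ls)"

text \<open>Coefficient of t^n at word w of phihat(z_ks), for an index ks.\<close>

definition phihat_idx :: "nat list \<Rightarrow> nat \<Rightarrow> letter list \<Rightarrow> rat" where
  "phihat_idx ks n w =
    (\<Sum>i\<in>{0..length ks}.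
       \<Sum>ls\<in>{ls. length ls = length ks - i \<and> sum_list ls = n}.
         (-1) ^ (sum_list (drop i ks)) * of_nat (bprod (drop i ks) ls)
         * of_nat (count (shuf (zw (take i ks)) (zw (rev (map2 (+) (drop i ks) ls)))) w))"

definition phihat :: "(letter list \<Rightarrow> rat) \<Rightarrow> nat \<Rightarrow> letter list \<Rightarrow> rat" where
  "phihat p n w = (\<Sum>ks\<in>{ks. pos_idx ks \<and> p (zw ks) \<noteq> 0}. p (zw ks) * phihat_idx ks n w)"

definition phi :: "(letter list \<Rightarrow> rat) \<Rightarrow> letter list \<Rightarrow> rat" where
  "phi p w = phihat p 0 w"

definition Zidx :: "nat \<Rightarrow> nat list \<Rightarrow> rat" where
  "Zidx M ks = (\<Sum>ns\<in>{ns. length ns = length ks \<and> sorted_wrt (<) ns \<and> set ns \<subseteq> {1..<M}}.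
                  \<Prod>i<length ks. (1 / of_nat (ns ! i)) ^ (ks ! i))"

definition Zmap :: "nat \<Rightarrow> (letter list \<Rightarrow> rat) \<Rightarrow> rat" where
  "Zmap M p = (\<Sum>ks\<in>{ks. pos_idx ks \<and> p (zw ks) \<noteq> 0}. p (zw ks) * Zidx M ks)"

definition path_edges :: "'v list \<Rightarrow> 'v set set" where
  "path_edges vs = set (map (\<lambda>(a, b). {a, b}) (zip vs (tl vs)))"

definition simple_path :: "'v set set \<Rightarrow> 'v list \<Rightarrow> bool" where
  "simple_path E vs \<longleftrightarrow> vs \<noteq> [] \<and> distinct vs \<and> path_edges vs \<subseteq> E"

definition is_tree :: "'v set \<Rightarrow> 'v set set \<Rightarrow> bool" where
  "is_tree V E \<longleftrightarrow> finite V \<and> V \<noteq> {}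
     \<and> (\<forall>e\<in>E. \<exists>a b. a \<in> V \<and> b \<in> V \<and> a \<noteq> b \<and> e = {a, b})
     \<and> (\<forall>a\<in>V. \<forall>b\<in>V. \<exists>vs. simple_path E vs \<and> hd vs = a \<and> last vs = b)
     \<and> (\<forall>vs vs'. simple_path E vs \<and> simple_path E vs' \<and> hd vs = hd vs' \<and> last vs = last vs'
                 \<longrightarrow> vs = vs')"

definition P :: "'v set set \<Rightarrow> 'v \<Rightarrow> 'v \<Rightarrow> 'v set set" where
  "P E a b = path_edges (THE vs. simple_path E vs \<and> hd vs = a \<and> last vs = b)"

definition degree :: "'v set set \<Rightarrow> 'v \<Rightarrow> nat" where
  "degree E v = card {e\<in>E. v \<in> e}"

definition two_colored_rooted_tree :: "'v set \<Rightarrow> 'v set set \<Rightarrow> 'v \<Rightarrow> 'v set \<Rightarrow> bool" where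
  "two_colored_rooted_tree V E rt Vb \<longleftrightarrow> is_tree V E \<and> rt \<in> V \<and> Vb \<subseteq> V
     \<and> (\<forall>v\<in>V. degree E v = 1 \<longrightarrow> v \<in> Vb)"

text \<open>An index on X is k :: 'v set => nat (only its values on E matter).\<close>

definition ess_pos :: "'v set set \<Rightarrow> 'v set \<Rightarrow> ('v set \<Rightarrow> nat) \<Rightarrow> bool" where
  "ess_pos E Vb k \<longleftrightarrow> (\<forall>v\<in>Vb. \<forall>v'\<in>Vb. v \<noteq> v' \<longrightarrow> 0 < sum k (P E v v'))"

definition zeta :: "nat \<Rightarrow> 'v set \<Rightarrow> 'v set set \<Rightarrow> 'v \<Rightarrow> 'v set \<Rightarrow> ('v set \<Rightarrow> nat) \<Rightarrow> rat" where
  "zeta M V E rt Vb k =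
    (\<Sum>m\<in>{m. (\<forall>v\<in>Vb. 1 \<le> m v) \<and> (\<forall>v. v \<notin> Vb \<longrightarrow> m v = 0) \<and> sum m Vb = M}.
       \<Prod>e\<in>E. (1 / of_nat (\<Sum>v\<in>{v\<in>Vb. e \<in> P E rt v}. m v)) ^ (k e))"

text \<open>w(X_h, k_h): the unique element w of H^1 with Z_M(w) = zeta_M(X;k) for all M >= 1.\<close>

definition wtree :: "'v set \<Rightarrow> 'v set set \<Rightarrow> 'v \<Rightarrow> 'v set \<Rightarrow> ('v set \<Rightarrow> nat) \<Rightarrow> letter list \<Rightarrow> rat" where
  "wtree V E rt Vb k = (THE w. in_H1 w \<and> (\<forall>M\<ge>1. Zmap M w = zeta M V E rt Vb k))"

end

theory Submission
  imports Defs "HOL-Computational_Algebra.Formal_Laurent_Series" "HOL-Computational_Algebra.Polynomial_FPS"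
begin

text \<open>
  An edge \<open>e\<close> enters \<open>\<zeta>\<^sub>M\<close> only through the set \<open>B\<^sub>e\<close> of black vertices \<open>v\<close> with
  \<open>e \<in> P(rt, v)\<close>. These sets form a laminar family, and essential positivity says that the \<open>B\<^sub>e\<close> with
  \<open>k\<^sub>e > 0\<close> separate black vertices. Moving the root to \<open>v\<close> replaces \<open>B\<^sub>e\<close> by its complement exactly
  when \<open>v \<in> B\<^sub>e\<close>, and the sum over \<open>l\<close> is the expansion of \<open>(t - m(V\<^sub>\<bullet> - B\<^sub>e))\<close> to the power
  \<open>-k\<^sub>e\<close>: formally, \<open>m(B\<^sub>e)\<close> with the total weight replaced by \<open>t\<close>. These quantities are additive
  on disjoint sets for every choice of the root \<open>v\<close>, so the partial fraction identity
  \<open>1/(a b) = (1/a + 1/b)/(a + b)\<close> gives the same linear relations on both sides of the claim. They reduce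
  every separating laminar family to chains, that is, to linear trees rooted at an end; there the claim is the
  definition of the symmetrization map together with the shuffle product formula for multiple
  polylogarithms. That \<open>(Z\<^sub>M)\<close> separates elements is the linear independence of multiple
  polylogarithms over rational functions with poles at 0 and 1.
\<close>

text \<open>The element w is known only through its values Z_M(w), while \<open>phihat\<close> acts
  on its expansion into words, so nothing can be computed from w directly. The induction therefore
  carries a statement with two halves about one and the same element (\<open>realizable\<close>):
  its values are the given sums, and the values of its symmetrization are the sums over all new
  roots. Both halves are linear in the element, so partial fractions transport them together.
  Separation by Z_M enters only afterwards, once to identify this element with the w of the theorem
  and once to pass from equal values to equal elements. Replacing the tree by a multiset of vertex
  sets makes a merge a single replacement, with no surgery on trees.\<close>

section \<open>Multiple polylogarithms and the shuffle product\<close>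

unbundle fps_syntax

text \<open>\<open>Lir w\<close> is the multiple polylogarithm of the reversal of \<open>w\<close>, so that the shuffle recursion and
  integration both act on the head of the list.\<close>

fun Lir :: "letter list \<Rightarrow> rat fps" where
  "Lir [] = 1"
| "Lir (LX # w) = Abs_fps (\<lambda>n. Lir w $ n / of_nat n)"
| "Lir (LY # w) = Abs_fps (\<lambda>n. (\<Sum>j<n. Lir w $ j) / of_nat n)"

definition H1_rev :: "letter list \<Rightarrow> bool" where
  "H1_rev w \<longleftrightarrow> w = [] \<or> last w = LY"

text \<open>The Euler operator X d/dX. It multiplies the n-th coefficient by n and so undoes the
  divisions in \<open>Lir\<close> without introducing 1/X.\<close>

definition theta :: "rat fps \<Rightarrow> rat fps" where
  "theta f = fps_X * fps_deriv f"

text \<open>The forms dX/X and dX/(1 - X) of the iterated integrals, divided by dX/X; for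
  \<open>LY\<close> this is X/(1 - X).\<close>

fun kernel :: "letter \<Rightarrow> rat fps" where
  "kernel LX = 1"
| "kernel LY = Abs_fps (\<lambda>n. if n = 0 then 0 else 1)"

lemma theta_nth: "theta f $ n = of_nat n * f $ n"
  by (cases n) (auto simp: theta_def)

lemma theta_add: "theta (f + g) = theta f + theta g"
  by (simp add: theta_def algebra_simps)

lemma theta_mult: "theta (f * g) = theta f * g + f * theta g"
  by (simp add: theta_def algebra_simps)

lemma theta_inject:
  assumes "theta f = theta g" "f $ 0 = g $ 0"
  shows "f = g"
proof (rule fps_ext)
  fix n
  have "of_nat n * f $ n = of_nat n * g $ n"
    using assms(1) theta_nth by metis
  then show "f $ n = g $ n"
    using assms(2) by (cases n) auto
qed

lemma theta_sum_mset: "theta (\<Sum>x\<in>#A. f x) = (\<Sum>x\<in>#A. theta (f x))"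
proof (induction A)
  case empty
  then show ?case by (simp add: theta_def)
qed (simp add: theta_add)

lemma kernel_LY_mult_nth: "(kernel LY * f) $ n = (\<Sum>j<n. f $ j)"
proof -
  have "(kernel LY * f) $ n = (\<Sum>i=0..n. f $ i * (kernel LY $ (n - i)))"
    by (subst mult.commute) (simp add: fps_mult_nth)
  also have "\<dots> = (\<Sum>i\<in>{..<n}. f $ i)"
    by (rule sum.mono_neutral_cong_right) auto
  finally show ?thesis .
qed

lemma Lir_nth_0: "Lir w $ 0 = (if w = [] then 1 else 0)"
  by (cases w rule: Lir.cases) auto

lemma H1_rev_Cons: "H1_rev (a # w) \<Longrightarrow> H1_rev w"
  by (auto simp: H1_rev_def split: if_splits)

text \<open>The hypothesis excludes words ending in \<open>LX\<close>. Their integral would start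
  with log X, whereas the division by \<open>of_nat 0\<close> would silently discard the constant
  term 1 of \<open>Lir []\<close>.\<close>

lemma theta_Lir:
  assumes "H1_rev (a # w)"
  shows "theta (Lir (a # w)) = kernel a * Lir w"
proof (rule fps_ext)
  fix n
  show "theta (Lir (a # w)) $ n = (kernel a * Lir w) $ n"
  proof (cases a)
    case LX
    with assms have "w \<noteq> []" by (auto simp: H1_rev_def)
    then show ?thesis using LX by (cases n) (auto simp: theta_nth Lir_nth_0)
  next
    case LY
    then show ?thesis unfolding LY kernel_LY_mult_nth by (cases n) (auto simp: theta_nth)
  qed
qed

text \<open>The last letter of a shuffle is the last letter of one of the two words. Emptiness is
  tracked as well because prefixing \<open>LX\<close> preserves \<open>H1_rev\<close> only on
  nonempty words.\<close>

lemma shuf_rev_H1: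
  assumes "H1_rev u" "H1_rev v" "w \<in># shuf_rev u v"
  shows "H1_rev w \<and> (w = [] \<longleftrightarrow> u = [] \<and> v = [])"
  using assms
proof (induction u v arbitrary: w rule: shuf_rev.induct)
  case (3 u1 a1 u2 a2)
  have H: "H1_rev a1" "H1_rev a2" using "3.prems" H1_rev_Cons by blast+
  from "3.prems"(3) consider
      w' where "w = u1 # w'" "w' \<in># shuf_rev a1 (u2 # a2)"
    | w' where "w = u2 # w'" "w' \<in># shuf_rev (u1 # a1) a2"
    by auto
  then show ?case
  proof cases
    case 1
    with "3.IH"(1)[OF H(1) "3.prems"(2) 1(2)] show ?thesis by (auto simp: H1_rev_def)
  next
    case 2
    with "3.IH"(2)[OF "3.prems"(1) H(2) 2(2)] show ?thesis by (auto simp: H1_rev_def)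
  qed
qed auto

text \<open>The Leibniz rule for \<open>theta\<close> has the same two terms as the shuffle
  recursion, so by induction both sides have the same image under \<open>theta\<close>; only the
  constant terms remain to be compared.\<close>

lemma Lir_shuf_rev:
  assumes "H1_rev u" "H1_rev v"
  shows "(\<Sum>w\<in>#shuf_rev u v. Lir w) = Lir u * Lir v"
  using assms
proof (induction u v rule: shuf_rev.induct)
  case (3 u1 a1 u2 a2)
  let ?u = "u1 # a1" and ?v = "u2 # a2"
  have H: "H1_rev a1" "H1_rev a2" using "3.prems" H1_rev_Cons by blast+
  have Cons: "(\<Sum>w\<in>#A. theta (Lir (a # w))) = kernel a * (\<Sum>w\<in>#A. Lir w)"
    if "\<And>w. w \<in># A \<Longrightarrow> H1_rev w \<and> w \<noteq> []" for A a
  proof -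
    have "(\<Sum>w\<in>#A. theta (Lir (a # w))) = (\<Sum>w\<in>#A. kernel a * Lir w)"
    proof (rule arg_cong[of _ _ sum_mset], rule image_mset_cong)
      fix w assume "w \<in># A"
      with that have "H1_rev (a # w)" by (auto simp: H1_rev_def)
      then show "theta (Lir (a # w)) = kernel a * Lir w" by (rule theta_Lir)
    qed
    then show ?thesis by (simp add: sum_mset_distrib_left)
  qed
  have 1: "(\<Sum>w\<in>#shuf_rev a1 ?v. theta (Lir (u1 # w))) = kernel u1 * (Lir a1 * Lir ?v)"
    using shuf_rev_H1[OF H(1) "3.prems"(2)] "3.IH"(1)[OF H(1) "3.prems"(2)] by (subst Cons) auto
  have 2: "(\<Sum>w\<in>#shuf_rev ?u a2. theta (Lir (u2 # w))) = kernel u2 * (Lir ?u * Lir a2)"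
    using shuf_rev_H1[OF "3.prems"(1) H(2)] "3.IH"(2)[OF "3.prems"(1) H(2)] by (subst Cons) auto
  show ?case
  proof (rule theta_inject)
    show "theta (\<Sum>w\<in>#shuf_rev ?u ?v. Lir w) = theta (Lir ?u * Lir ?v)"
      unfolding theta_mult theta_Lir[OF "3.prems"(1)] theta_Lir[OF "3.prems"(2)] theta_sum_mset
      using 1 2 by (simp add: image_mset.compositionality comp_def algebra_simps del: Lir.simps)
    \<comment> \<open>All words occurring here are nonempty, so both constant terms are 0.\<close>
    have "(\<Sum>w\<in>#A. Lir w) $ 0 = 0" if "\<And>w. w \<in># A \<Longrightarrow> w \<noteq> []" for A
      using that by (induction A) (auto simp: Lir_nth_0)
    moreover have "\<And>w. w \<in># shuf_rev ?u ?v \<Longrightarrow> w \<noteq> []" by auto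
    ultimately show "(\<Sum>w\<in>#shuf_rev ?u ?v. Lir w) $ 0 = (Lir ?u * Lir ?v) $ 0"
      by (simp add: Lir_nth_0 del: shuf_rev.simps Lir.simps)
  qed
qed auto

section \<open>Rational functions with poles at 0 and 1\<close>

text \<open>Laurent series contain the polylogarithms together with 1/X and 1/(1 - X), so relations
  with rational coefficients can be written and differentiated there.\<close>

definition fls_of_poly :: "rat poly \<Rightarrow> rat fls" where
  "fls_of_poly Q = fps_to_fls (fps_of_poly Q)"

lemma fls_of_poly_add: "fls_of_poly (Q + S) = fls_of_poly Q + fls_of_poly S"
  by (simp add: fls_of_poly_def fps_of_poly_add)

lemma fls_of_poly_diff: "fls_of_poly (Q - S) = fls_of_poly Q - fls_of_poly S"
  by (simp add: fls_of_poly_def fps_of_poly_diff)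

lemma fls_of_poly_mult: "fls_of_poly (Q * S) = fls_of_poly Q * fls_of_poly S"
  by (simp add: fls_of_poly_def fps_of_poly_mult fls_times_fps_to_fls)

lemma fls_of_poly_power: "fls_of_poly (Q ^ n) = fls_of_poly Q ^ n"
  by (simp add: fls_of_poly_def fps_of_poly_power fps_to_fls_power)

lemma fls_of_poly_pderiv: "fls_of_poly (pderiv Q) = fls_deriv (fls_of_poly Q)"
  by (simp add: fls_of_poly_def fps_of_poly_pderiv fls_deriv_fps_to_fls)

lemma fls_of_poly_inject: "fls_of_poly Q = fls_of_poly S \<longleftrightarrow> Q = S"
  by (simp add: fls_of_poly_def fps_of_poly_eq_iff)

lemma fls_of_poly_const: "fls_of_poly [:a:] = fls_const a"
  by (simp add: fls_of_poly_def fps_of_poly_const)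

lemma fls_of_poly_X: "fls_of_poly [:0, 1:] = fls_X"
  by (simp add: fls_of_poly_def fps_of_poly_fps_X)

definition inv_1mX :: "rat fls" where
  "inv_1mX = fps_to_fls (Abs_fps (\<lambda>_. 1))"

lemma inv_1mX: "inv_1mX * (1 - fls_X) = 1"
proof -
  have "Abs_fps (\<lambda>_. 1) * (1 - fps_X) = (1 :: rat fps)"
    by (rule fps_ext) (simp add: algebra_simps fps_X_mult_nth)
  then have "fps_to_fls (Abs_fps (\<lambda>_. 1) * (1 - fps_X)) = (1 :: rat fls)" by simp
  then show ?thesis by (simp add: inv_1mX_def fls_times_fps_to_fls)
qed

lemma inv_X: "fls_X_inv * (fls_X :: rat fls) = 1"
  by (simp add: fls_X_inv_times_conv_shift)

lemma fls_kernel_LY: "fps_to_fls (kernel LY) = fls_X * inv_1mX"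
proof -
  have "kernel LY = fps_X * Abs_fps (\<lambda>_. 1)"
    by (rule fps_ext) (simp add: fps_X_mult_nth)
  then show ?thesis by (simp add: inv_1mX_def fls_times_fps_to_fls)
qed

definition xg :: "rat poly" where "xg = [:0, 1:] * [:1, -1:]"

lemma fls_xg: "fls_of_poly xg = fls_X * (1 - fls_X)"
proof -
  have "[:1, -1:] = [:1:] - [:0, 1 :: rat:]" by simp
  then have "fls_of_poly [:1, -1:] = 1 - fls_X"
    by (simp only: fls_of_poly_diff fls_of_poly_X fls_of_poly_const fls_const_1)
  then show ?thesis
    unfolding xg_def fls_of_poly_mult fls_of_poly_X by simp
qed

lemma fls_xg_nz: "fls_of_poly xg \<noteq> 0"
proof
  assume "fls_of_poly xg = 0"
  then have "fls_of_poly xg = fls_of_poly 0" by (simp add: fls_of_poly_def)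
  then show False by (simp add: fls_of_poly_inject xg_def)
qed

text \<open>Membership in \<open>\<rat>[X, X\<^sup>-\<^sup>1, (1 - X)\<^sup>-\<^sup>1]\<close>.\<close>

definition pole01 :: "rat fls \<Rightarrow> bool" where
  "pole01 f \<longleftrightarrow> (\<exists>e Q. f * fls_of_poly xg ^ e = fls_of_poly Q)"

lemma pole01_poly: "pole01 (fls_of_poly Q)"
  unfolding pole01_def by (rule exI[of _ 0]) auto

lemma pole01_const: "pole01 (fls_const a)"
  using pole01_poly[of "[:a:]"] by (simp add: fls_of_poly_const)

lemma pole01_add:
  assumes "pole01 f" "pole01 g"
  shows "pole01 (f + g)"
proof -
  obtain a Q b S where f: "f * fls_of_poly xg ^ a = fls_of_poly Q"
    and g: "g * fls_of_poly xg ^ b = fls_of_poly S"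
    using assms by (auto simp: pole01_def)
  have "(f + g) * fls_of_poly xg ^ (a + b)
      = (f * fls_of_poly xg ^ a) * fls_of_poly xg ^ b + (g * fls_of_poly xg ^ b) * fls_of_poly xg ^ a"
    by (simp add: power_add algebra_simps)
  also have "\<dots> = fls_of_poly (Q * xg ^ b + S * xg ^ a)"
    by (simp add: f g fls_of_poly_add fls_of_poly_mult fls_of_poly_power)
  finally show ?thesis unfolding pole01_def by blast
qed

lemma pole01_mult:
  assumes "pole01 f" "pole01 g"
  shows "pole01 (f * g)"
proof -
  obtain a Q b S where f: "f * fls_of_poly xg ^ a = fls_of_poly Q"
    and g: "g * fls_of_poly xg ^ b = fls_of_poly S"
    using assms by (auto simp: pole01_def)
  have "(f * g) * fls_of_poly xg ^ (a + b)
      = (f * fls_of_poly xg ^ a) * (g * fls_of_poly xg ^ b)"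
    by (simp add: power_add algebra_simps)
  also have "\<dots> = fls_of_poly (Q * S)"
    by (simp add: f g fls_of_poly_mult)
  finally show ?thesis unfolding pole01_def by blast
qed

text \<open>The quotient rule for Q / \<open>xg\<close>^e. The numerator is kept explicit because
  \<open>no_rational_log\<close> reads a polynomial equation off it.\<close>

lemma pole01_deriv_eq:
  assumes "f * fls_of_poly xg ^ e = fls_of_poly Q"
  shows "fls_deriv f * fls_of_poly xg ^ Suc e
    = fls_of_poly (xg * pderiv Q - [:of_nat e:] * pderiv xg * Q)"
proof -
  let ?g = "fls_of_poly xg"
  have "fls_deriv f * ?g ^ e + f * fls_deriv (?g ^ e) = fls_of_poly (pderiv Q)"
    unfolding fls_of_poly_pderiv assms[symmetric] by simp
  then have "fls_deriv f * ?g ^ Suc e + f * (?g * fls_deriv (?g ^ e)) = ?g * fls_of_poly (pderiv Q)"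
    by (metis (no_types, lifting) distrib_left mult.left_commute power_Suc)
  moreover have "?g * fls_deriv (?g ^ e) = of_nat e * fls_deriv ?g * ?g ^ e"
    by (induction e) (simp_all add: algebra_simps)
  ultimately have "fls_deriv f * ?g ^ Suc e
      = ?g * fls_of_poly (pderiv Q) - of_nat e * fls_deriv ?g * (f * ?g ^ e)"
    by (simp add: algebra_simps)
  then show ?thesis
    unfolding assms fls_of_poly_diff fls_of_poly_mult fls_of_poly_pderiv fls_of_poly_const
    by (simp add: fls_of_nat)
qed

lemma pole01_deriv: "pole01 f \<Longrightarrow> pole01 (fls_deriv f)"
  using pole01_deriv_eq unfolding pole01_def by blast

lemma pole01_inv_X: "pole01 fls_X_inv"
proof -
  have "fls_X_inv * fls_of_poly xg ^ 1 = fls_of_poly (1 - [:0, 1:])"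
    using inv_X unfolding fls_xg fls_of_poly_diff fls_of_poly_X
    by (simp add: fls_of_poly_const one_pCons flip: mult.assoc)
  then show ?thesis unfolding pole01_def by blast
qed

lemma pole01_inv_1mX: "pole01 inv_1mX"
proof -
  have "inv_1mX * fls_of_poly xg ^ 1 = (inv_1mX * (1 - fls_X)) * fls_X"
    unfolding fls_xg by (simp add: algebra_simps)
  also have "\<dots> = fls_of_poly [:0, 1:]" by (simp add: inv_1mX fls_of_poly_X)
  finally show ?thesis unfolding pole01_def by blast
qed

text \<open>This is the equation satisfied by the numerator \<open>Q\<close> of \<open>f = Q / (X\<^sup>a (1 - X)\<^sup>c)\<close>
  when \<open>f' = - b / (1 - X)\<close>.\<close>

lemma no_rational_log_poly:
  fixes Q :: "rat poly"
  assumes "[:0, 1:] * [:1, -1:] * pderiv Q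
    = - [:b:] * [:0, 1:] ^ Suc a * [:1, -1:] ^ c + ([:of_nat a:] * [:1, -1:] - [:of_nat c:] * [:0, 1:]) * Q"
  shows "b = 0"
  using assms
proof (induction c arbitrary: Q)
  case 0
  \<comment> \<open>At X = 1 only the term with b survives.\<close>
  from arg_cong[OF this, of "\<lambda>p. poly p 1"] show ?case by simp
next
  case (Suc c)
  let ?x = "[:0, 1 :: rat:]" and ?y = "[:1, -1 :: rat:]"
  \<comment> \<open>At X = 1 the equation says that (c + 1) Q(1) vanishes, so 1 - X divides
    Q.\<close>
  from arg_cong[OF Suc.prems, of "\<lambda>p. poly p 1"] have "(1 + of_nat c) * poly Q 1 = 0"
    by (simp add: algebra_simps)
  then have "poly Q 1 = 0"
    by (metis mult_eq_0_iff of_nat_Suc of_nat_eq_0_iff nat.distinct(1))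
  then have "[:-1, 1:] dvd Q" by (simp add: poly_eq_0_iff_dvd)
  then obtain S0 where "Q = [:-1, 1:] * S0" by blast
  then have "Q = ?y * (- S0)" by simp
  then obtain S where S: "Q = ?y * S" by blast
  have y': "pderiv ?y = - 1" by (simp add: pderiv_pCons one_pCons)
  have c: "[:of_nat (Suc c):] = [:of_nat c:] + (1 :: rat poly)" by (simp add: one_pCons)
  have d: "pderiv Q = ?y * pderiv S - S"
    unfolding S pderiv_mult y' by simp
  \<comment> \<open>One factor 1 - X is split off the equation; the term - S in the derivative of (1
    - X) S lowers c + 1 to c.\<close>
  have ring: "y * (x * y * s') = y * (- b' * xa * yc + (a' * y - c' * x) * s)"
    if "x * y * (y * s' - s) = - b' * xa * (y * yc) + (a' * y - (c' + 1) * x) * (y * s)"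
    for x y s' s b' xa yc a' c' :: "rat poly"
    using that by (simp add: algebra_simps)
  have "?y * (?x * ?y * pderiv S) = ?y * (- [:b:] * ?x ^ Suc a * ?y ^ c
      + ([:of_nat a:] * ?y - [:of_nat c:] * ?x) * S)"
    by (rule ring) (rule Suc.prems[unfolded d c, unfolded S, unfolded power_Suc[of "[:1, -1 :: rat:]"]])
  then have "?x * ?y * pderiv S = - [:b:] * ?x ^ Suc a * ?y ^ c
      + ([:of_nat a:] * ?y - [:of_nat c:] * ?x) * S"
    by (subst (asm) mult_cancel_left) auto
  then show ?case by (rule Suc.IH)
qed

text \<open>Neither log X nor log (1 - X), nor any nontrivial combination of the two, is rational.
  This is the only analytic input to linear independence.\<close>

lemma no_rational_log:
  assumes "pole01 f"
    and "fls_deriv f + fls_const a * fls_X_inv + fls_const b * inv_1mX = 0"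
  shows "a = 0" "b = 0"
proof -
  \<comment> \<open>The coefficient of 1/X: a derivative has no residue, and 1/(1 - X) is a power
    series.\<close>
  have "(fls_deriv f + fls_const a * fls_X_inv + fls_const b * inv_1mX) $$ (-1) = 0"
    by (simp add: assms(2))
  then show a: "a = 0"
    by (simp add: inv_1mX_def)
  obtain e Q where eQ: "f * fls_of_poly xg ^ e = fls_of_poly Q"
    using assms(1) by (auto simp: pole01_def)
  have "fls_deriv f = - fls_const b * inv_1mX"
    using assms(2) a by (simp add: eq_neg_iff_add_eq_0)
  then have "fls_deriv f * fls_of_poly xg ^ Suc e
      = - fls_const b * (inv_1mX * (1 - fls_X)) * fls_X * fls_of_poly xg ^ e"
    unfolding fls_xg by (simp add: algebra_simps)
  also have "\<dots> = fls_of_poly (- [:b:] * [:0, 1:] * xg ^ e)"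
    unfolding inv_1mX fls_of_poly_mult fls_of_poly_power fls_of_poly_X
    using fls_of_poly_diff[of 0 "[:b:]"] fls_of_poly_const[of 0]
    by (simp add: fls_of_poly_const)
  finally have "- [:b:] * [:0, 1:] * xg ^ e = xg * pderiv Q - [:of_nat e:] * pderiv xg * Q"
    unfolding pole01_deriv_eq[OF eQ] fls_of_poly_inject by simp
  also have "pderiv xg = [:1, -1:] - [:0, 1:]"
    by (simp add: xg_def pderiv_mult pderiv_pCons)
  finally have *: "- [:b:] * [:0, 1:] * xg ^ e
      = xg * pderiv Q - [:of_nat e:] * ([:1, -1:] - [:0, 1:]) * Q" .
  have ring: "x * y * q' = - b' * (x * xe) * ye + (e' * y - e' * x) * q"
    if "- b' * x * (xe * ye) = x * y * q' - e' * (y - x) * q"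
    for b' x y xe ye q' e' q :: "rat poly"
    using that by (simp add: algebra_simps)
  \<comment> \<open>The denominator is a power of X (1 - X), so both exponents of
    \<open>no_rational_log_poly\<close> equal e.\<close>
  have "[:0, 1:] * [:1, -1:] * pderiv Q
      = - [:b:] * [:0, 1:] ^ Suc e * [:1, -1:] ^ e
        + ([:of_nat e:] * [:1, -1:] - [:of_nat e:] * [:0, 1:]) * Q"
    unfolding power_Suc by (rule ring) (rule *[unfolded xg_def power_mult_distrib])
  then show "b = 0" by (rule no_rational_log_poly)
qed

section \<open>Linear independence of multiple polylogarithms\<close>

definition words :: "nat \<Rightarrow> letter list set" where
  "words N = {u. length u \<le> N}"

lemma finite_words: "finite (words N)"
proof -
  have "UNIV = {LX, LY}" using letter.exhaust by blast
  then have "finite (UNIV :: letter set)" by (metis finite.emptyI finite.insertI)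
  from finite_lists_length_le[OF this, of N] show ?thesis by (simp add: words_def)
qed

lemma sum_words_Suc:
  "(\<Sum>u\<in>words (Suc N). f u) = f [] + (\<Sum>w\<in>words N. f (LX # w) + (f (LY # w) :: rat fls))"
proof -
  have eq: "words (Suc N) = insert [] (Cons LX ` words N \<union> Cons LY ` words N)"
  proof (rule set_eqI)
    fix u show "u \<in> words (Suc N) \<longleftrightarrow> u \<in> insert [] (Cons LX ` words N \<union> Cons LY ` words N)"
    proof (cases u)
      case (Cons a w)
      then show ?thesis by (cases a) (auto simp: words_def image_iff)
    qed (auto simp: words_def)
  qed
  have "(\<Sum>u\<in>words (Suc N). f u) = f [] + (\<Sum>u\<in>Cons LX ` words N \<union> Cons LY ` words N. f u)"
    unfolding eq by (subst sum.insert) (auto simp: finite_words)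
  also have "(\<Sum>u\<in>Cons LX ` words N \<union> Cons LY ` words N. f u)
      = (\<Sum>u\<in>Cons LX ` words N. f u) + (\<Sum>u\<in>Cons LY ` words N. f u)"
    by (rule sum.union_disjoint) (auto simp: finite_words)
  also have "\<dots> = (\<Sum>w\<in>words N. f (LX # w) + f (LY # w))"
    by (simp add: sum.reindex sum.distrib)
  finally show ?thesis .
qed

abbreviation lfl :: "letter list \<Rightarrow> rat fls" where
  "lfl u \<equiv> fps_to_fls (Lir u)"

lemma fls_X_mult_deriv_lfl:
  assumes "H1_rev (a # w)"
  shows "fls_X * fls_deriv (lfl (a # w)) = fps_to_fls (kernel a) * lfl w"
proof -
  have "fps_to_fls (theta (Lir (a # w))) = fps_to_fls (kernel a * Lir w)"
    by (simp only: theta_Lir[OF assms])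
  then show ?thesis
    by (simp add: theta_def fls_times_fps_to_fls fls_deriv_fps_to_fls del: Lir.simps kernel.simps)
qed

lemma deriv_lfl_LX:
  assumes "H1_rev (LX # w)"
  shows "fls_deriv (lfl (LX # w)) = fls_X_inv * lfl w"
proof -
  have "fls_X_inv * (fls_X * fls_deriv (lfl (LX # w))) = fls_X_inv * lfl w"
    unfolding fls_X_mult_deriv_lfl[OF assms] by simp
  then show ?thesis using inv_X by (simp add: mult.assoc[symmetric])
qed

lemma deriv_lfl_LY: "fls_deriv (lfl (LY # w)) = inv_1mX * lfl w" if "H1_rev (LY # w)"
proof -
  have "fls_X * fls_deriv (lfl (LY # w)) = fls_X * (inv_1mX * lfl w)"
    unfolding fls_X_mult_deriv_lfl[OF that] fls_kernel_LY by (simp add: mult.assoc)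
  then show ?thesis by (subst (asm) mult_cancel_left) auto
qed

text \<open>The coefficient of \<open>lfl u\<close> in the derivative of a relation. Differentiation
  strips the head of a word, so the two words one letter longer contribute to u.\<close>

definition deriv_rel :: "(letter list \<Rightarrow> rat fls) \<Rightarrow> letter list \<Rightarrow> rat fls" where
  "deriv_rel c u = fls_deriv (c u) + c (LX # u) * fls_X_inv + c (LY # u) * inv_1mX"

definition rel_on :: "nat \<Rightarrow> (letter list \<Rightarrow> rat fls) \<Rightarrow> bool" where
  "rel_on N c \<longleftrightarrow> (\<forall>u. pole01 (c u)) \<and> (\<forall>u. c u \<noteq> 0 \<longrightarrow> H1_rev u \<and> length u \<le> N)
     \<and> (\<Sum>u\<in>words N. c u * lfl u) = 0"

lemma rel_on_deriv:
  assumes "rel_on N c"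
  shows "rel_on N (deriv_rel c)"
proof -
  have pole: "pole01 (c u)" and supp: "c u \<noteq> 0 \<Longrightarrow> H1_rev u \<and> length u \<le> N" for u
    using assms by (auto simp: rel_on_def)
  have zero: "(\<Sum>u\<in>words N. c u * lfl u) = 0" using assms by (auto simp: rel_on_def)
  have "0 = fls_deriv (\<Sum>u\<in>words N. c u * lfl u)" by (simp add: zero)
  also have "\<dots> = (\<Sum>u\<in>words N. fls_deriv (c u) * lfl u) + (\<Sum>u\<in>words N. c u * fls_deriv (lfl u))"
    by (simp add: fls_deriv_sum sum.distrib add.commute)
  \<comment> \<open>Padding with words of length \<open>Suc N\<close>, whose coefficients vanish,
    lets every nonempty word be split at its head.\<close>
  also have "(\<Sum>u\<in>words N. c u * fls_deriv (lfl u)) = (\<Sum>u\<in>words (Suc N). c u * fls_deriv (lfl u))"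
  proof (rule sum.mono_neutral_left)
    show "\<forall>u\<in>words (Suc N) - words N. c u * fls_deriv (lfl u) = 0"
      using supp by (fastforce simp: words_def)
  qed (auto simp: finite_words, auto simp: words_def)
  also have "\<dots> = (\<Sum>w\<in>words N. c (LX # w) * fls_deriv (lfl (LX # w)) + c (LY # w) * fls_deriv (lfl (LY # w)))"
    unfolding sum_words_Suc by simp
  also have "\<dots> = (\<Sum>w\<in>words N. c (LX # w) * fls_X_inv * lfl w + c (LY # w) * inv_1mX * lfl w)"
  proof (rule sum.cong[OF refl])
    fix w
    have "c (LX # w) * fls_deriv (lfl (LX # w)) = c (LX # w) * fls_X_inv * lfl w"
      using deriv_lfl_LX[of w] supp[of "LX # w"] by (cases "c (LX # w) = 0") (simp_all del: Lir.simps add: mult.assoc)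
    moreover have "c (LY # w) * fls_deriv (lfl (LY # w)) = c (LY # w) * inv_1mX * lfl w"
      using deriv_lfl_LY[of w] supp[of "LY # w"] by (cases "c (LY # w) = 0") (simp_all del: Lir.simps add: mult.assoc)
    ultimately show "c (LX # w) * fls_deriv (lfl (LX # w)) + c (LY # w) * fls_deriv (lfl (LY # w))
      = c (LX # w) * fls_X_inv * lfl w + c (LY # w) * inv_1mX * lfl w" by (rule arg_cong2)
  qed
  finally have "(\<Sum>u\<in>words N. deriv_rel c u * lfl u) = 0"
    by (simp add: deriv_rel_def algebra_simps sum.distrib)
  moreover have "pole01 (deriv_rel c u)" for u
    unfolding deriv_rel_def
    by (intro pole01_add pole01_mult pole01_deriv pole pole01_inv_X pole01_inv_1mX)
  moreover have "H1_rev u \<and> length u \<le> N" if "deriv_rel c u \<noteq> 0" for u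
  proof -
    have "c u \<noteq> 0 \<or> c (LX # u) \<noteq> 0 \<or> c (LY # u) \<noteq> 0"
      using that by (auto simp: deriv_rel_def)
    then show ?thesis using supp[of u] supp[of "LX # u"] supp[of "LY # u"] H1_rev_Cons by fastforce
  qed
  ultimately show ?thesis by (auto simp: rel_on_def)
qed

lemma rel_on_drop_top:
  assumes "rel_on (Suc N) c" "\<And>u. length u = Suc N \<Longrightarrow> c u = 0"
  shows "rel_on N c"
proof -
  have "(\<Sum>u\<in>words N. c u * lfl u) = (\<Sum>u\<in>words (Suc N). c u * lfl u)"
    by (rule sum.mono_neutral_left) (use assms(2) in \<open>auto simp: finite_words, auto simp: words_def le_Suc_eq\<close>)
  then show ?thesis using assms unfolding rel_on_def by (metis le_Suc_eq)
qed

text \<open>Differentiating lowers the degree of polynomial coefficients of words of maximal length, and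
  once these are constant a further derivative is a relation among shorter words.\<close>

lemma Lir_independent:
  assumes "rel_on N c"
  shows "c u = 0"
  using assms
proof (induction N arbitrary: c u)
  case 0
  then have z: "(\<Sum>u\<in>words 0. c u * lfl u) = 0" and s: "\<And>u. c u \<noteq> 0 \<Longrightarrow> length u \<le> 0"
    by (auto simp: rel_on_def)
  have "words 0 = {[]}" by (auto simp: words_def)
  with z have "c [] = 0" by simp
  with s[of u] show ?case by (cases u) auto
next
  case (Suc N)
  \<comment> \<open>If the coefficients of the longest words are constant, the derived relation
    involves shorter words only and vanishes by induction. At the tail of u this is the equation
    excluded by \<open>no_rational_log\<close>.\<close>
  have const: "c' u = 0" if rel: "rel_on (Suc N) c'" and d: "\<And>u. length u = Suc N \<Longrightarrow> fls_deriv (c' u) = 0"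
    and u: "length u = Suc N" for c' u
  proof -
    have long: "c' v = 0" if "length v > Suc N" for v
      using rel that unfolding rel_on_def by (meson linorder_not_le)
    have "deriv_rel c' v = 0" if "length v = Suc N" for v
      using that d long by (simp add: deriv_rel_def)
    with rel_on_deriv[OF rel] have "rel_on N (deriv_rel c')" by (rule rel_on_drop_top)
    then have z: "deriv_rel c' v = 0" for v by (rule Suc.IH)
    obtain a w where aw: "u = a # w" "length w = N" using u by (cases u) auto
    have "\<exists>x. c' (b # w) = fls_const x" for b
      using d[of "b # w"] aw fls_deriv_eq_0_iff by auto
    then obtain x where x: "\<And>b. c' (b # w) = fls_const (x b)" by metis
    have "x LX = 0 \<and> x LY = 0"
      using no_rational_log[of "c' w" "x LX" "x LY"] z[of w] rel
      unfolding deriv_rel_def x rel_on_def by blast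
    then show ?thesis using x[of a] aw by (cases a) auto
  qed
  \<comment> \<open>Induction on the number of derivatives that annihilate the top coefficients. No
    longer words contribute there, so \<open>deriv_rel\<close> simply differentiates them.\<close>
  have poly: "c' u = 0" if "rel_on (Suc N) c'" "\<And>u. length u = Suc N \<Longrightarrow> (fls_deriv ^^ Suc d) (c' u) = 0"
    "length u = Suc N" for d c' u
    using that
  proof (induction d arbitrary: c' u)
    case 0
    then show ?case using const by simp
  next
    case (Suc d)
    have top: "deriv_rel c' v = fls_deriv (c' v)" if "length v = Suc N" for v
    proof -
      have "c' (a # v) = 0" for a
        using Suc.prems(1) that unfolding rel_on_def by (metis Suc_n_not_le_n length_Cons)
      then show ?thesis by (simp add: deriv_rel_def)
    qed
    have "deriv_rel c' v = 0" if "length v = Suc N" for v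
    proof (rule Suc.IH[OF rel_on_deriv[OF Suc.prems(1)]])
      show "(fls_deriv ^^ Suc d) (deriv_rel c' u) = 0" if "length u = Suc N" for u
        unfolding top[OF that] using Suc.prems(2)[OF that] funpow_swap1[of fls_deriv "Suc d" "c' u"] by simp
    qed (fact that)
    then show ?case using const[OF Suc.prems(1)] Suc.prems(3) top by simp
  qed
  have pole: "pole01 (c v)" for v using Suc.prems by (auto simp: rel_on_def)
  then obtain e Q where eQ: "\<And>v. c v * fls_of_poly xg ^ e v = fls_of_poly (Q v)"
    unfolding pole01_def by metis
  \<comment> \<open>The sum bounds every \<open>e v\<close>, so this one power of \<open>xg\<close>
    clears all denominators; D below bounds the degrees in the same way.\<close>
  define E where "E = (\<Sum>v\<in>words (Suc N). e v)"
  define c' where "c' v = c v * fls_of_poly xg ^ E" for v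
  have "\<exists>S. c' v = fls_of_poly S" if "v \<in> words (Suc N)" for v
  proof -
    have "e v \<le> E" unfolding E_def using that finite_words by (intro member_le_sum) auto
    then have "c' v = (c v * fls_of_poly xg ^ e v) * fls_of_poly xg ^ (E - e v)"
      unfolding c'_def mult.assoc power_add[symmetric] by simp
    also have "\<dots> = fls_of_poly (Q v * xg ^ (E - e v))"
      by (simp add: eQ fls_of_poly_mult fls_of_poly_power)
    finally show ?thesis by blast
  qed
  then obtain S where S: "\<And>v. v \<in> words (Suc N) \<Longrightarrow> c' v = fls_of_poly (S v)" by metis
  define D where "D = (\<Sum>v\<in>words (Suc N). Polynomial.degree (S v))"
  have kill: "(fls_deriv ^^ Suc D) (c' v) = 0" if "v \<in> words (Suc N)" for v
  proof -
    have "Polynomial.degree (S v) \<le> D" unfolding D_def using that finite_words by (intro member_le_sum) auto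
    then have "(pderiv ^^ Suc D) (S v) = 0"
      by (intro poly_eqI) (simp add: coeff_higher_pderiv coeff_eq_0 del: funpow.simps)
    moreover have "(fls_deriv ^^ n) (fls_of_poly p) = fls_of_poly ((pderiv ^^ n) p)" for n p
      by (induction n) (auto simp: fls_of_poly_pderiv)
    ultimately show ?thesis using S[OF that] by (simp add: fls_of_poly_def del: funpow.simps)
  qed
  have "(\<Sum>u\<in>words (Suc N). c' u * lfl u) = (\<Sum>u\<in>words (Suc N). c u * lfl u) * fls_of_poly xg ^ E"
    unfolding sum_distrib_right by (rule sum.cong) (auto simp: c'_def)
  then have "rel_on (Suc N) c'"
    using Suc.prems pole01_mult[OF pole] pole01_poly[of "xg ^ E"]
    unfolding rel_on_def by (auto simp: c'_def fls_of_poly_power)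
  then have "c' v = 0" if "length v = Suc N" for v
    by (rule poly[of _ D]) (use kill that in \<open>auto simp: words_def simp del: funpow.simps\<close>)
  then have "c v = 0" if "length v = Suc N" for v
    using that fls_xg_nz by (simp add: c'_def)
  with Suc.prems have "rel_on N c" by (rule rel_on_drop_top)
  then show ?case by (rule Suc.IH)
qed

section \<open>The maps \<open>Z\<^sub>M\<close> and \<open>phihat\<close> on words\<close>

definition H1_word :: "letter list \<Rightarrow> bool" where
  "H1_word u \<longleftrightarrow> u = [] \<or> hd u = LY"

lemma H1_rev_rev: "H1_rev (rev u) \<longleftrightarrow> H1_word u"
  by (auto simp: H1_rev_def H1_word_def last_rev)

lemma zw_Nil: "zw [] = []"
  by (simp add: zw_def)

lemma zw_Cons: "zw (k # ks) = zk k @ zw ks"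
  by (simp add: zw_def)

lemma zw_snoc: "zw (ks @ [k]) = zw ks @ zk k"
  by (simp add: zw_def)

lemma H1_word_zw: "H1_word (zw ks)"
  by (cases ks) (auto simp: H1_word_def zw_Nil zw_Cons zk_def)

text \<open>Each part is recovered from the run of \<open>LX\<close> behind its \<open>LY\<close>.
  Positivity matters because \<open>zk 0\<close> and \<open>zk 1\<close> are the same word.\<close>

lemma zw_inj:
  assumes "pos_idx ks" "pos_idx ls" "zw ks = zw ls"
  shows "ks = ls"
  using assms
proof (induction ks arbitrary: ls)
  case Nil
  then show ?case by (cases ls) (auto simp: zw_Nil zw_Cons zk_def)
next
  case (Cons k ks)
  then obtain l ls' where ls: "ls = l # ls'" by (cases ls) (auto simp: zw_Nil zw_Cons zk_def)
  have eq: "replicate (k - 1) LX @ zw ks = replicate (l - 1) LX @ zw ls'"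
    using Cons.prems(3) by (simp add: ls zw_Cons zk_def)
  have tw: "takeWhile (\<lambda>a. a = LX) (replicate n LX @ zw js) = replicate n LX" for n js
    using H1_word_zw[of js] by (cases "zw js") (auto simp: H1_word_def takeWhile_append)
  have "replicate (k - 1) LX = replicate (l - 1) LX"
    using arg_cong[OF eq, of "takeWhile (\<lambda>a. a = LX)"] by (simp only: tw)
  then have kl: "k - 1 = l - 1" by (metis length_replicate)
  then have "k = l" using Cons.prems(1,2) by (auto simp: ls pos_idx_def)
  moreover have "zw ks = zw ls'" using eq kl by simp
  ultimately show ?case using Cons.IH[of ls'] Cons.prems by (auto simp: ls pos_idx_def)
qed

lemma inj_on_zw: "inj_on zw {ks. pos_idx ks}"
  using zw_inj by (auto simp: inj_on_def)

text \<open>Read from the left, a letter \<open>LY\<close> opens a new part 1 and a letter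
  \<open>LX\<close> increases the last part.\<close>

lemma zw_surj:
  assumes "H1_word u"
  shows "\<exists>ks. pos_idx ks \<and> zw ks = u"
  using assms
proof (induction u rule: rev_induct)
  case Nil
  then show ?case by (intro exI[of _ "[]"]) (auto simp: pos_idx_def zw_Nil)
next
  case (snoc a u)
  then have "H1_word u" by (cases u) (auto simp: H1_word_def)
  with snoc.IH obtain ks where ks: "pos_idx ks" "zw ks = u" by blast
  show ?case
  proof (cases a)
    case LY
    then show ?thesis using ks
      by (intro exI[of _ "ks @ [1]"]) (auto simp: pos_idx_def zw_snoc zk_def)
  next
    case LX
    then have "u \<noteq> []" using snoc.prems by (auto simp: H1_word_def)
    then obtain js j where j: "ks = js @ [j]" using ks zw_Nil by (metis rev_exhaust)
    have "replicate j LX = replicate (j - 1) LX @ [LX]"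
      using ks j by (cases j) (auto simp: pos_idx_def replicate_append_same)
    then show ?thesis using ks j LX
      by (intro exI[of _ "js @ [Suc j]"]) (auto simp: pos_idx_def zw_snoc zk_def)
  qed
qed

section \<open>Multiple harmonic sums as partial sums of coefficients\<close>

definition Zword :: "nat \<Rightarrow> letter list \<Rightarrow> rat" where
  "Zword M u = (\<Sum>n<M. Lir (rev u) $ n)"

text \<open>The parts serve as the gaps of an increasing sequence n_1 < ... < n_r = n, and later as
  the weights along a linear tree.\<close>

definition comps :: "nat \<Rightarrow> nat \<Rightarrow> nat list set" where
  "comps r n = {as. length as = r \<and> (\<forall>a\<in>set as. 1 \<le> a) \<and> sum_list as = n}"

lemma finite_comps: "finite (comps r n)"
proof (rule finite_subset)
  show "comps r n \<subseteq> {as. set as \<subseteq> {..n} \<and> length as = r}"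
    using member_le_sum_list by (fastforce simp: comps_def)
qed (simp add: finite_lists_length_eq)

text \<open>The sum of f_1(n_1) ... f_r(n_r) over n_1 < ... < n_r = n, written through gaps. The
  ring is arbitrary because values in \<open>rat\<close> and in power series in t both
  occur.\<close>

definition nested_sum :: "(nat \<Rightarrow> 'a::comm_ring_1) list \<Rightarrow> nat \<Rightarrow> 'a" where
  "nested_sum fs n = (\<Sum>as\<in>comps (length fs) n. \<Prod>j<length fs. (fs ! j) (sum_list (take (Suc j) as)))"

lemma nested_sum_Nil: "nested_sum [] n = (if n = 0 then 1 else 0)"
proof -
  have "comps 0 n = (if n = 0 then {[]} else {})" by (auto simp: comps_def)
  then show ?thesis by (simp add: nested_sum_def)
qed

lemma nested_sum_snoc: "nested_sum (fs @ [f]) n = f n * (\<Sum>j<n. nested_sum fs j)"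
proof -
  let ?r = "length fs"
  let ?S = "SIGMA j:{..<n}. comps ?r j"
  have "(\<Sum>as\<in>comps (Suc ?r) n. \<Prod>j<Suc ?r. ((fs @ [f]) ! j) (sum_list (take (Suc j) as)))
    = (\<Sum>(j, as)\<in>?S. f n * (\<Prod>j<?r. (fs ! j) (sum_list (take (Suc j) as))))"
  proof (rule sum.reindex_bij_witness[of _ "\<lambda>(j, as). as @ [n - j]" "\<lambda>as. (sum_list (butlast as), butlast as)"])
    fix as assume "as \<in> comps (Suc ?r) n"
    then obtain bs b where as: "as = bs @ [b]" "length bs = ?r" "1 \<le> b" "\<forall>a\<in>set bs. 1 \<le> a" "sum_list bs + b = n"
      by (cases as rule: rev_cases) (auto simp: comps_def)
    then show "(case (sum_list (butlast as), butlast as) of (j, as) \<Rightarrow> as @ [n - j]) = as"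
      by auto
    show "(sum_list (butlast as), butlast as) \<in> ?S"
      using as by (auto simp: comps_def)
    show "(case (sum_list (butlast as), butlast as) of (j, as) \<Rightarrow> f n * (\<Prod>j<?r. (fs ! j) (sum_list (take (Suc j) as))))
      = (\<Prod>j<Suc ?r. ((fs @ [f]) ! j) (sum_list (take (Suc j) as)))"
      using as by (simp add: nth_append mult.commute)
  next
    fix p assume p: "p \<in> ?S"
    then show "(sum_list (butlast (case p of (j, as) \<Rightarrow> as @ [n - j])), butlast (case p of (j, as) \<Rightarrow> as @ [n - j])) = p"
      by (auto simp: comps_def)
    show "(case p of (j, as) \<Rightarrow> as @ [n - j]) \<in> comps (Suc ?r) n"
      using p by (auto simp: comps_def)
  qed
  also have "\<dots> = (\<Sum>j<n. \<Sum>as\<in>comps ?r j. f n * (\<Prod>j<?r. (fs ! j) (sum_list (take (Suc j) as))))"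
    by (subst sum.Sigma) (auto simp: finite_comps)
  also have "\<dots> = f n * (\<Sum>j<n. nested_sum fs j)"
    by (simp add: nested_sum_def sum_distrib_left)
  finally show ?thesis by (simp add: nested_sum_def)
qed

abbreviation inv_pow :: "nat \<Rightarrow> nat \<Rightarrow> rat" where
  "inv_pow k n \<equiv> (1 / of_nat n) ^ k"

lemma Lir_replicate_LX: "Lir (replicate i LX @ w) $ n = Lir w $ n / of_nat n ^ i"
  by (induction i) auto

text \<open>A reversed block \<open>zk k\<close> consists of k - 1 divisions by n, from the letters
  \<open>LX\<close>, followed by one more division and a strict summation, from
  \<open>LY\<close>.\<close>

lemma Lir_zw_nth:
  assumes "pos_idx ks"
  shows "Lir (rev (zw ks)) $ n = nested_sum (map inv_pow ks) n"
  using assms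
proof (induction ks arbitrary: n rule: rev_induct)
  case Nil
  then show ?case by (simp add: zw_Nil nested_sum_Nil)
next
  case (snoc k ks)
  then have k: "k > 0" and ks: "pos_idx ks" by (auto simp: pos_idx_def)
  have "rev (zw (ks @ [k])) = replicate (k - 1) LX @ LY # rev (zw ks)"
    by (simp add: zw_snoc zk_def)
  then have "Lir (rev (zw (ks @ [k]))) $ n = (\<Sum>j<n. Lir (rev (zw ks)) $ j) / of_nat n / of_nat n ^ (k - 1)"
    by (simp add: Lir_replicate_LX)
  also have "\<dots> = inv_pow k n * (\<Sum>j<n. Lir (rev (zw ks)) $ j)"
    using k by (cases k) (auto simp: field_simps power_divide)
  also have "\<dots> = nested_sum (map inv_pow (ks @ [k])) n"
    using snoc.IH[OF ks] by (simp add: nested_sum_snoc)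
  finally show ?case .
qed

lemma Zidx_snoc: "Zidx M (ks @ [k]) = (\<Sum>n\<in>{1..<M}. inv_pow k n * Zidx n ks)"
proof -
  let ?r = "length ks"
  define NS where "NS r M = {ns :: nat list. length ns = r \<and> sorted_wrt (<) ns \<and> set ns \<subseteq> {1..<M}}" for r M
  have fin: "finite (NS r M)" for r M
    by (rule finite_subset[of _ "{ns. set ns \<subseteq> {1..<M} \<and> length ns = r}"])
      (auto simp: NS_def finite_lists_length_eq)
  let ?S = "SIGMA n:{1..<M}. NS ?r n"
  have "(\<Sum>ns\<in>NS (Suc ?r) M. \<Prod>i<Suc ?r. inv_pow ((ks @ [k]) ! i) (ns ! i))
    = (\<Sum>(n, ns)\<in>?S. inv_pow k n * (\<Prod>i<?r. inv_pow (ks ! i) (ns ! i)))"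
  proof (rule sum.reindex_bij_witness[of _ "\<lambda>(n, ns). ns @ [n]" "\<lambda>ns. (last ns, butlast ns)"])
    fix ns assume "ns \<in> NS (Suc ?r) M"
    then obtain ms m where ns: "ns = ms @ [m]" "length ms = ?r" "ms @ [m] \<in> NS (Suc ?r) M"
      by (cases ns rule: rev_cases) (auto simp: NS_def)
    then show "(case (last ns, butlast ns) of (n, ns) \<Rightarrow> ns @ [n]) = ns" by simp
    show "(last ns, butlast ns) \<in> ?S"
      using ns by (auto simp: NS_def sorted_wrt_append)
    show "(case (last ns, butlast ns) of (n, ns) \<Rightarrow> inv_pow k n * (\<Prod>i<?r. inv_pow (ks ! i) (ns ! i)))
      = (\<Prod>i<Suc ?r. inv_pow ((ks @ [k]) ! i) (ns ! i))"
      using ns by (simp add: nth_append mult.commute)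
  next
    fix p assume p: "p \<in> ?S"
    then show "(last (case p of (n, ns) \<Rightarrow> ns @ [n]), butlast (case p of (n, ns) \<Rightarrow> ns @ [n])) = p"
      by auto
    show "(case p of (n, ns) \<Rightarrow> ns @ [n]) \<in> NS (Suc ?r) M"
      using p by (fastforce simp: NS_def sorted_wrt_append)
  qed
  also have "\<dots> = (\<Sum>n\<in>{1..<M}. \<Sum>ns\<in>NS ?r n. inv_pow k n * (\<Prod>i<?r. inv_pow (ks ! i) (ns ! i)))"
    by (subst sum.Sigma) (auto simp: fin)
  also have "\<dots> = (\<Sum>n\<in>{1..<M}. inv_pow k n * Zidx n ks)"
    by (simp add: Zidx_def NS_def sum_distrib_left)
  finally show ?thesis by (simp add: Zidx_def NS_def)
qed

text \<open>Both sides obey the recursion that removes the largest summation index. They differ at M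
  = 0, where the empty index gives 1 on the left and an empty sum on the right.\<close>

lemma Zidx_eq_Zword:
  assumes "pos_idx ks" "M \<ge> 1"
  shows "Zidx M ks = Zword M (zw ks)"
  using assms
proof (induction ks arbitrary: M rule: rev_induct)
  case Nil
  have "{ns :: nat list. ns = [] \<and> sorted_wrt (<) ns \<and> set ns \<subseteq> {1..<M}} = {[]}" by auto
  moreover have "Zword M [] = 1"
    using Nil by (simp add: Zword_def fps_one_nth)
  ultimately show ?case by (simp add: Zidx_def zw_Nil)
next
  case (snoc k ks)
  then have ks: "pos_idx ks" by (auto simp: pos_idx_def)
  have "Zidx M (ks @ [k]) = (\<Sum>n\<in>{1..<M}. inv_pow k n * Zword n (zw ks))"
    unfolding Zidx_snoc using snoc.IH[OF ks] by simp
  \<comment> \<open>The added term n = 0 vanishes because \<open>Zword 0\<close> is an empty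
    sum.\<close>
  also have "\<dots> = (\<Sum>n<M. inv_pow k n * Zword n (zw ks))"
    by (rule sum.mono_neutral_left) (auto simp: Zword_def Suc_le_eq)
  also have "\<dots> = (\<Sum>n<M. nested_sum (map inv_pow (ks @ [k])) n)"
    by (simp add: nested_sum_snoc Zword_def Lir_zw_nth[OF ks])
  also have "\<dots> = Zword M (zw (ks @ [k]))"
    by (simp only: Zword_def Lir_zw_nth[OF snoc.prems(1)])
  finally show ?case .
qed

section \<open>Linearity on H1 and separation by Z_M\<close>

lemma in_H1_iff: "in_H1 p \<longleftrightarrow> finite (supp p) \<and> (\<forall>u\<in>supp p. H1_word u)"
  by (auto simp: in_H1_def supp_def H1_word_def)

text \<open>The index sets in \<open>Zmap\<close> and \<open>phihat\<close> depend on p. Passing to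
  any finite set U of words containing the support gives different elements a common range, from
  which linearity follows.\<close>

lemma index_sum_eq_word_sum:
  fixes f :: "letter list \<Rightarrow> rat"
  assumes "in_H1 p" "finite U" "supp p \<subseteq> U"
  shows "(\<Sum>ks | pos_idx ks \<and> p (zw ks) \<noteq> 0. p (zw ks) * f (zw ks)) = (\<Sum>u\<in>U. p u * f u)"
proof -
  let ?K = "{ks. pos_idx ks \<and> p (zw ks) \<noteq> 0}"
  have im: "zw ` ?K = supp p"
    using assms(1) zw_surj by (force simp: in_H1_iff supp_def)
  have inj: "inj_on zw ?K" by (rule inj_on_subset[OF inj_on_zw]) auto
  have "(\<Sum>ks\<in>?K. p (zw ks) * f (zw ks)) = (\<Sum>u\<in>zw ` ?K. p u * f u)"
    by (simp add: sum.reindex[OF inj] comp_def)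
  also have "\<dots> = (\<Sum>u\<in>U. p u * f u)"
    unfolding im by (rule sum.mono_neutral_left) (use assms in \<open>auto simp: supp_def\<close>)
  finally show ?thesis .
qed

lemma Zmap_eq:
  assumes "in_H1 p" "finite U" "supp p \<subseteq> U" "M \<ge> 1"
  shows "Zmap M p = (\<Sum>u\<in>U. p u * Zword M u)"
proof -
  have "Zmap M p = (\<Sum>ks | pos_idx ks \<and> p (zw ks) \<noteq> 0. p (zw ks) * Zword M (zw ks))"
    unfolding Zmap_def using Zidx_eq_Zword assms(4) by (intro sum.cong) auto
  then show ?thesis using index_sum_eq_word_sum[OF assms(1-3)] by simp
qed

definition idx_of :: "letter list \<Rightarrow> nat list" where
  "idx_of u = inv_into {ks. pos_idx ks} zw u"

lemma idx_of_zw: "pos_idx ks \<Longrightarrow> idx_of (zw ks) = ks"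
  unfolding idx_of_def using inv_into_f_f[OF inj_on_zw] by auto

lemma phihat_eq:
  assumes "in_H1 p" "finite U" "supp p \<subseteq> U"
  shows "phihat p n w = (\<Sum>u\<in>U. p u * phihat_idx (idx_of u) n w)"
proof -
  have "phihat p n w = (\<Sum>ks | pos_idx ks \<and> p (zw ks) \<noteq> 0. p (zw ks) * phihat_idx (idx_of (zw ks)) n w)"
    unfolding phihat_def by (intro sum.cong) (auto simp: idx_of_zw)
  then show ?thesis using index_sum_eq_word_sum[OF assms] by simp
qed

lemma in_H1_zero: "in_H1 (\<lambda>_. 0)"
  by (simp add: in_H1_def supp_def)

lemma in_H1_add: "in_H1 p \<Longrightarrow> in_H1 q \<Longrightarrow> in_H1 (\<lambda>u. p u + q u)"
proof -
  assume a: "in_H1 p" "in_H1 q"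
  have "supp (\<lambda>u. p u + q u) \<subseteq> supp p \<union> supp q" by (auto simp: supp_def)
  then show ?thesis using a unfolding in_H1_iff by (meson UnE finite_UnI finite_subset subsetD)
qed

lemma in_H1_scale: "in_H1 p \<Longrightarrow> in_H1 (\<lambda>u. c * p u)"
proof -
  assume a: "in_H1 p"
  have "supp (\<lambda>u. c * p u) \<subseteq> supp p" by (auto simp: supp_def)
  then show ?thesis using a unfolding in_H1_iff by (meson finite_subset subsetD)
qed

lemma in_H1_sum:
  assumes "\<And>i. i \<in> I \<Longrightarrow> in_H1 (p i)"
  shows "in_H1 (\<lambda>u. \<Sum>i\<in>I. p i u)"
  using assms
proof (induction I rule: infinite_finite_induct)
  case (insert i I)
  then show ?case using in_H1_add[of "p i" "\<lambda>u. \<Sum>i\<in>I. p i u"] by simp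
qed (auto simp: in_H1_zero)

lemma Zmap_zero: "Zmap M (\<lambda>_. 0) = 0"
  by (simp add: Zmap_def)

lemma Zmap_add:
  assumes "in_H1 p" "in_H1 q" "M \<ge> 1"
  shows "Zmap M (\<lambda>u. p u + q u) = Zmap M p + Zmap M q"
proof -
  let ?U = "supp p \<union> supp q"
  have U: "finite ?U" "supp p \<subseteq> ?U" "supp q \<subseteq> ?U" "supp (\<lambda>u. p u + q u) \<subseteq> ?U"
    using assms by (auto simp: in_H1_iff supp_def)
  show ?thesis
    using Zmap_eq[OF assms(1) U(1,2) assms(3)] Zmap_eq[OF assms(2) U(1,3) assms(3)]
      Zmap_eq[OF in_H1_add[OF assms(1,2)] U(1,4) assms(3)]
    by (simp add: sum.distrib algebra_simps)
qed

lemma Zmap_scale: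
  assumes "in_H1 p" "M \<ge> 1"
  shows "Zmap M (\<lambda>u. c * p u) = c * Zmap M p"
proof -
  have U: "finite (supp p)" "supp p \<subseteq> supp p" "supp (\<lambda>u. c * p u) \<subseteq> supp p"
    using assms by (auto simp: in_H1_iff supp_def)
  show ?thesis
    using Zmap_eq[OF assms(1) U(1,2) assms(2)] Zmap_eq[OF in_H1_scale[OF assms(1)] U(1,3) assms(2)]
    by (simp add: sum_distrib_left mult.assoc)
qed

lemma Zmap_sum:
  assumes "\<And>i. i \<in> I \<Longrightarrow> in_H1 (p i)" "M \<ge> 1"
  shows "Zmap M (\<lambda>u. \<Sum>i\<in>I. p i u) = (\<Sum>i\<in>I. Zmap M (p i))"
  using assms
proof (induction I rule: infinite_finite_induct)
  case (insert i I)
  then show ?case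
    using Zmap_add[of "p i" "\<lambda>u. \<Sum>i\<in>I. p i u" M] in_H1_sum[of I p] by simp
qed (auto simp: Zmap_zero)

lemma phihat_add:
  assumes "in_H1 p" "in_H1 q"
  shows "phihat (\<lambda>u. p u + q u) n = (\<lambda>w. phihat p n w + phihat q n w)"
proof
  fix w
  let ?U = "supp p \<union> supp q"
  have U: "finite ?U" "supp p \<subseteq> ?U" "supp q \<subseteq> ?U" "supp (\<lambda>u. p u + q u) \<subseteq> ?U"
    using assms by (auto simp: in_H1_iff supp_def)
  show "phihat (\<lambda>u. p u + q u) n w = phihat p n w + phihat q n w"
    unfolding phihat_eq[OF assms(1) U(1,2)] phihat_eq[OF assms(2) U(1,3)]
      phihat_eq[OF in_H1_add[OF assms] U(1,4)]
    by (simp add: sum.distrib algebra_simps)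
qed

text \<open>The difference of Z_(n+1) and Z_n is the n-th coefficient of the polylogarithm. Equal
  values for all M thus give a relation with constant coefficients among the series
  \<open>Lir\<close>, which \<open>Lir_independent\<close> rules out.\<close>

lemma Zmap_inject:
  assumes "in_H1 p" "in_H1 q" "\<And>M. M \<ge> 1 \<Longrightarrow> Zmap M p = Zmap M q"
  shows "p = q"
proof -
  define d where "d u = p u + (-1) * q u" for u
  have d: "in_H1 d" unfolding d_def by (intro in_H1_add in_H1_scale assms(1,2))
  let ?U = "supp d"
  have fin: "finite ?U" using d by (simp add: in_H1_iff)
  have Z: "(\<Sum>u\<in>?U. d u * Zword M u) = 0" if "M \<ge> 1" for M
  proof -
    have "Zmap M d = 0"
      using Zmap_add[OF assms(1) in_H1_scale[OF assms(2), of "-1"] that]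
        Zmap_scale[OF assms(2) that, of "-1"] assms(3)[OF that] by (simp add: d_def[abs_def])
    then show ?thesis using Zmap_eq[OF d fin subset_refl that] by simp
  qed
  have "(\<Sum>u\<in>?U. d u * Lir (rev u) $ n) = 0" for n
  proof -
    have "(\<Sum>u\<in>?U. d u * Zword (Suc n) u) = (\<Sum>u\<in>?U. d u * Zword n u) + (\<Sum>u\<in>?U. d u * Lir (rev u) $ n)"
      by (simp add: Zword_def algebra_simps sum.distrib)
    \<comment> \<open>The hypothesis starts at M = 1; for n = 0 every \<open>Zword n u\<close> is an
      empty sum.\<close>
    moreover have "(\<Sum>u\<in>?U. d u * Zword n u) = 0"
      using Z[of n] by (cases n) (auto simp: Zword_def)
    ultimately show ?thesis using Z[of "Suc n"] by simp
  qed
  then have "(\<Sum>u\<in>?U. fps_const (d u) * Lir (rev u)) = 0"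
    by (intro fps_ext) (simp add: fps_sum_nth)
  then have "fps_to_fls (\<Sum>u\<in>?U. fps_const (d u) * Lir (rev u)) = 0" by simp
  moreover have "fps_to_fls (sum f A) = (\<Sum>u\<in>A. fps_to_fls (f u))"
    for f :: "letter list \<Rightarrow> rat fps" and A
    by (induction A rule: infinite_finite_induct) auto
  ultimately have sum0: "(\<Sum>u\<in>?U. fls_const (d u) * lfl (rev u)) = 0"
    by (simp add: fls_times_fps_to_fls)
  define N where "N = (\<Sum>u\<in>?U. length u)"
  define c where "c u = fls_const (d (rev u))" for u
  have supp: "H1_rev u \<and> length u \<le> N" if "c u \<noteq> 0" for u
  proof -
    have u: "rev u \<in> ?U" using that by (auto simp: c_def supp_def)
    then have "length (rev u) \<le> N" unfolding N_def using fin by (intro member_le_sum) auto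
    moreover have "H1_word (rev u)" using u d by (simp add: in_H1_iff)
    ultimately show ?thesis using H1_rev_rev[of "rev u"] by simp
  qed
  have "(\<Sum>u\<in>words N. c u * lfl u) = (\<Sum>u\<in>rev ` ?U. c u * lfl u)"
  proof (rule sum.mono_neutral_right)
    show "rev ` ?U \<subseteq> words N"
    proof (rule image_subsetI)
      fix u assume "u \<in> ?U"
      then have "c (rev u) \<noteq> 0" by (simp add: c_def supp_def)
      then show "rev u \<in> words N" using supp[of "rev u"] by (simp add: words_def)
    qed
    show "\<forall>u\<in>words N - rev ` ?U. c u * lfl u = 0"
    proof
      fix u assume "u \<in> words N - rev ` ?U"
      then have "rev u \<notin> ?U" by (metis Diff_iff imageI rev_rev_ident)
      then show "c u * lfl u = 0" by (simp add: c_def supp_def)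
    qed
  qed (rule finite_words)
  also have "\<dots> = 0"
    using sum0 by (simp add: sum.reindex c_def)
  finally have "rel_on N c"
    using supp pole01_const unfolding rel_on_def c_def by blast
  then have "c u = 0" for u by (rule Lir_independent)
  then have "d u = 0" for u
    by (metis c_def fls_const_nonzero rev_rev_ident)
  then show ?thesis by (auto simp: d_def)
qed

section \<open>Values of Z_M on shuffles, symmetrizations and single words\<close>

lemma sum_count_eq_sum_mset:
  fixes f :: "'a \<Rightarrow> rat"
  assumes "finite U" "set_mset A \<subseteq> U"
  shows "(\<Sum>u\<in>U. of_nat (count A u) * f u) = (\<Sum>u\<in>#A. f u)"
  using assms(2)
proof (induction A)
  case (add x A)
  have "(\<Sum>u\<in>U. of_nat (count (add_mset x A) u) * f u)
      = (\<Sum>u\<in>U. (if u = x then f u else 0) + of_nat (count A u) * f u)"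
    by (rule sum.cong) (auto simp: algebra_simps)
  then show ?case using add assms(1) by (simp add: sum.distrib)
qed simp

lemma H1_word_shuf:
  assumes "H1_word u" "H1_word v" "w \<in># shuf u v"
  shows "H1_word w"
  using assms shuf_rev_H1[of "rev u" "rev v"] H1_rev_rev unfolding shuf_def by force

lemma in_H1_shuf:
  assumes "H1_word u" "H1_word v"
  shows "in_H1 (\<lambda>w. of_nat (count (shuf u v) w))"
proof -
  have "supp (\<lambda>w. of_nat (count (shuf u v) w)) = set_mset (shuf u v)"
    by (auto simp: supp_def)
  then show ?thesis using H1_word_shuf[OF assms] by (auto simp: in_H1_iff)
qed

text \<open>Z_M itself is not multiplicative for the shuffle. The generating series are, so the
  truncation applies to the total degree of their product.\<close>

lemma Zmap_shuf:
  assumes "H1_word u" "H1_word v" "M \<ge> 1"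
  shows "Zmap M (\<lambda>w. of_nat (count (shuf u v) w)) = (\<Sum>n<M. (Lir (rev u) * Lir (rev v)) $ n)"
proof -
  have "Zmap M (\<lambda>w. of_nat (count (shuf u v) w)) = (\<Sum>w\<in>#shuf u v. Zword M w)"
    by (subst Zmap_eq[OF in_H1_shuf[OF assms(1,2)] _ _ assms(3), of "set_mset (shuf u v)"])
      (auto simp: supp_def sum_count_eq_sum_mset)
  also have "\<dots> = (\<Sum>w\<in>#shuf_rev (rev u) (rev v). \<Sum>n<M. Lir w $ n)"
    by (simp add: shuf_def Zword_def image_mset.compositionality comp_def)
  also have "\<dots> = (\<Sum>n<M. (\<Sum>w\<in>#shuf_rev (rev u) (rev v). Lir w) $ n)"
  proof -
    have "(\<Sum>w\<in>#A. \<Sum>n<M. Lir w $ n) = (\<Sum>n<M. (\<Sum>w\<in>#A. Lir w) $ n)" for A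
      by (induction A) (auto simp: sum.distrib)
    then show ?thesis .
  qed
  also have "\<dots> = (\<Sum>n<M. (Lir (rev u) * Lir (rev v)) $ n)"
    using assms by (simp add: Lir_shuf_rev H1_rev_rev)
  finally show ?thesis .
qed

lemma in_H1_phihat_idx: "in_H1 (phihat_idx ks n)"
  unfolding phihat_idx_def[abs_def]
  by (intro in_H1_sum in_H1_scale in_H1_shuf H1_word_zw)

lemma Zmap_phihat_idx:
  assumes "M \<ge> 1"
  shows "Zmap M (phihat_idx ks n) = (\<Sum>i\<in>{0..length ks}.
       \<Sum>ls | length ls = length ks - i \<and> sum_list ls = n.
         (-1) ^ (sum_list (drop i ks)) * of_nat (bprod (drop i ks) ls)
         * (\<Sum>N<M. (Lir (rev (zw (take i ks))) * Lir (rev (zw (rev (map2 (+) (drop i ks) ls))))) $ N))"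
  unfolding phihat_idx_def[abs_def]
  by (simp add: Zmap_sum[OF _ assms] Zmap_scale[OF _ assms] Zmap_shuf[OF _ _ assms]
      in_H1_sum in_H1_scale in_H1_shuf H1_word_zw)

lemma in_H1_phihat:
  assumes "in_H1 p"
  shows "in_H1 (phihat p n)"
proof -
  have "phihat p n = (\<lambda>w. \<Sum>u\<in>supp p. p u * phihat_idx (idx_of u) n w)"
    using phihat_eq[OF assms _ subset_refl] assms by (auto simp: in_H1_iff)
  then show ?thesis by (simp add: in_H1_sum in_H1_scale in_H1_phihat_idx)
qed

definition single :: "letter list \<Rightarrow> letter list \<Rightarrow> rat" where
  "single u w = (if w = u then 1 else 0)"

lemma supp_single: "supp (single u) = {u}"
  by (auto simp: supp_def single_def)

lemma in_H1_single: "H1_word u \<Longrightarrow> in_H1 (single u)"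
  by (simp add: in_H1_iff supp_single)

lemma Zmap_single: "H1_word u \<Longrightarrow> M \<ge> 1 \<Longrightarrow> Zmap M (single u) = Zword M u"
  by (subst Zmap_eq[of _ "{u}"]) (auto simp: in_H1_single supp_single, simp add: single_def)

lemma phihat_single: "pos_idx ks \<Longrightarrow> phihat (single (zw ks)) n = phihat_idx ks n"
proof
  fix w assume "pos_idx ks"
  then show "phihat (single (zw ks)) n w = phihat_idx ks n w"
    by (subst phihat_eq[of _ "{zw ks}"])
      (auto simp: in_H1_single supp_single H1_word_zw idx_of_zw, simp add: single_def)
qed

section \<open>Linear trees\<close>

text \<open>From here on \<open>fps_X\<close> is the variable t of H[[t]], no longer the argument of
  the polylogarithms.\<close>

definition shift_pow :: "nat \<Rightarrow> nat \<Rightarrow> rat fps" where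
  "shift_pow k N = inverse (fps_X - fps_const (of_nat N)) ^ k"

text \<open>The binomial expansion of (t - N)^(-k) = (-1)^k N^(-k) (1 - t/N)^(-k). It is the source
  of both the sign and the binomial coefficients in the symmetrization map.\<close>

lemma shift_pow_nth:
  assumes "N \<ge> 1"
  shows "shift_pow k N $ l = (-1) ^ k * of_nat (bin k l) * inv_pow (k + l) N"
proof -
  define c :: rat where "c = of_nat N"
  have c: "c \<noteq> 0" using assms by (simp add: c_def)
  let ?f = "fps_X - fps_const c"
  define F where "F k = Abs_fps (\<lambda>l. (-1) ^ k * of_nat (bin k l) * (1 / c) ^ (k + l))" for k
  have F0: "F 0 = 1"
    by (rule fps_ext) (simp add: F_def bin_def)
  have FS: "?f * F (Suc k) = F k" for k
  proof (rule fps_ext)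
    fix l
    show "(?f * F (Suc k)) $ l = F k $ l"
    proof (cases l)
      case 0
      then show ?thesis using c by (simp add: F_def bin_def field_simps)
    next
      case (Suc m)
      \<comment> \<open>Pascal's rule; for k = 0 it is the convention that \<open>bin 0 l\<close>
        vanishes for positive l.\<close>
      have b: "of_nat (bin (Suc k) l) = (of_nat (bin (Suc k) m) + of_nat (bin k l) :: rat)"
        unfolding Suc bin_def by (cases k) (auto simp: algebra_simps)
      have "(?f * F (Suc k)) $ l = F (Suc k) $ m - c * F (Suc k) $ l"
        by (simp add: Suc left_diff_distrib)
      also have "\<dots> = (-1) ^ k * (1 / c) ^ (k + l) * (of_nat (bin (Suc k) l) - of_nat (bin (Suc k) m))"
        using c by (simp add: F_def Suc field_simps)
      also have "\<dots> = F k $ l" unfolding b by (simp add: F_def)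
      finally show ?thesis .
    qed
  qed
  have "inverse ?f ^ k = F k" for k
  proof (induction k)
    case (Suc k)
    have "inverse ?f ^ Suc k = (inverse ?f * ?f) * F (Suc k)"
      using Suc by (simp add: mult.assoc FS)
    also have "inverse ?f * ?f = 1" using c by (intro inverse_mult_eq_1) simp
    finally show ?case by simp
  qed (simp add: F0)
  then show ?thesis by (simp add: shift_pow_def F_def c_def)
qed

definition weaks :: "nat \<Rightarrow> nat \<Rightarrow> nat list set" where
  "weaks r n = {ls. length ls = r \<and> sum_list ls = n}"

lemma finite_weaks: "finite (weaks r n)"
proof (rule finite_subset)
  show "weaks r n \<subseteq> {ls. set ls \<subseteq> {..n} \<and> length ls = r}"
    using member_le_sum_list by (fastforce simp: weaks_def)
qed (simp add: finite_lists_length_eq)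

lemma sum_weaks_Suc: "(\<Sum>ls\<in>weaks (Suc r) n. F ls) = (\<Sum>l=0..n. \<Sum>ls\<in>weaks r (n - l). F (l # ls))"
proof -
  let ?S = "SIGMA l:{0..n}. weaks r (n - l)"
  have "(\<Sum>ls\<in>weaks (Suc r) n. F ls) = (\<Sum>(l, ls)\<in>?S. F (l # ls))"
    by (rule sum.reindex_bij_witness[of _ "\<lambda>(l, ls). l # ls" "\<lambda>ls. (hd ls, tl ls)"])
      (auto simp: weaks_def length_Suc_conv)
  also have "\<dots> = (\<Sum>l=0..n. \<Sum>ls\<in>weaks r (n - l). F (l # ls))"
    by (subst sum.Sigma) (auto simp: finite_weaks)
  finally show ?thesis .
qed

text \<open>Expanding every factor by \<open>shift_pow_nth\<close> produces the inner sum over l of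
  \<open>phihat_idx\<close>; the reversal matches the reversed index there.\<close>

lemma nested_sum_shift_nth:
  "nested_sum (map shift_pow (rev ds)) b $ n = (\<Sum>ls\<in>weaks (length ds) n.
     (-1) ^ sum_list ds * of_nat (bprod ds ls) * nested_sum (map inv_pow (rev (map2 (+) ds ls))) b)"
proof (induction ds arbitrary: b n)
  case Nil
  have "weaks 0 n = (if n = 0 then {[]} else {})" by (auto simp: weaks_def)
  then show ?case by (simp add: nested_sum_Nil bprod_def fps_one_nth)
next
  case (Cons d ds)
  show ?case
  proof (cases "b = 0")
    case True
    \<comment> \<open>For b = 0 both sides contain an empty sum over j < b; the expansion of
      \<open>shift_pow\<close> is available only for b >= 1.\<close>
    have "nested_sum (map inv_pow (rev (map2 (+) (d # ds) ls))) b = 0" if "ls \<in> weaks (Suc (length ds)) n" for ls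
      using that True by (cases ls) (auto simp: weaks_def nested_sum_snoc)
    then show ?thesis by (simp add: nested_sum_snoc True)
  next
    case False
    then have b: "b \<ge> 1" by simp
    let ?T = "\<lambda>ls j. nested_sum (map inv_pow (rev (map2 (+) ds ls))) j"
    have "nested_sum (map shift_pow (rev (d # ds))) b $ n
      = (\<Sum>l=0..n. shift_pow d b $ l * (\<Sum>j<b. nested_sum (map shift_pow (rev ds)) j $ (n - l)))"
      by (simp add: nested_sum_snoc fps_mult_nth fps_sum_nth)
    also have "\<dots> = (\<Sum>l=0..n. \<Sum>ls\<in>weaks (length ds) (n - l).
      (-1) ^ sum_list (d # ds) * of_nat (bprod (d # ds) (l # ls)) * (inv_pow (d + l) b * (\<Sum>j<b. ?T ls j)))"
    proof (rule sum.cong[OF refl])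
      fix l
      have "(\<Sum>j<b. nested_sum (map shift_pow (rev ds)) j $ (n - l)) = (\<Sum>ls\<in>weaks (length ds) (n - l).
         (-1) ^ sum_list ds * of_nat (bprod ds ls) * (\<Sum>j<b. ?T ls j))"
        unfolding Cons.IH sum_distrib_left by (rule sum.swap)
      then show "shift_pow d b $ l * (\<Sum>j<b. nested_sum (map shift_pow (rev ds)) j $ (n - l))
        = (\<Sum>ls\<in>weaks (length ds) (n - l).
      (-1) ^ sum_list (d # ds) * of_nat (bprod (d # ds) (l # ls)) * (inv_pow (d + l) b * (\<Sum>j<b. ?T ls j)))"
        unfolding shift_pow_nth[OF b] by (simp add: sum_distrib_left bprod_def power_add ac_simps)
    qed
    finally show ?thesis by (simp add: sum_weaks_Suc nested_sum_snoc)
  qed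
qed

text \<open>Neither F nor G sees the part at position i, the weight of the new root. It equals M -
  N, and its positivity becomes N < M; what remains is the truncated Cauchy product of
  \<open>Zmap_shuf\<close>.\<close>

lemma sum_comps_split:
  fixes F G :: "nat list \<Rightarrow> 'a::comm_ring_1"
  assumes "i \<le> r"
  shows "(\<Sum>ms\<in>comps (Suc r) M. F (take i ms) * G (drop (Suc i) ms))
    = (\<Sum>N<M. \<Sum>a=0..N. (\<Sum>as\<in>comps i a. F as) * (\<Sum>bs\<in>comps (r - i) (N - a). G bs))"
proof -
  let ?S = "SIGMA N:{..<M}. SIGMA a:{0..N}. comps i a \<times> comps (r - i) (N - a)"
  have "(\<Sum>ms\<in>comps (Suc r) M. F (take i ms) * G (drop (Suc i) ms)) = (\<Sum>(N, a, as, bs)\<in>?S. F as * G bs)"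
  proof (rule sum.reindex_bij_witness[of _ "\<lambda>(N, a, as, bs). as @ [M - N] @ bs"
        "\<lambda>ms. (sum_list (take i ms) + sum_list (drop (Suc i) ms), sum_list (take i ms), take i ms, drop (Suc i) ms)"])
    fix ms assume ms: "ms \<in> comps (Suc r) M"
    then have "i < length ms" using assms by (simp add: comps_def)
    then have eq: "ms = take i ms @ [ms ! i] @ drop (Suc i) ms"
      by (simp add: id_take_nth_drop)
    have s: "M = sum_list (take i ms) + (ms ! i + sum_list (drop (Suc i) ms))"
      using ms arg_cong[OF eq, of sum_list] by (simp add: comps_def)
    have p: "0 < ms ! i" using ms nth_mem[OF \<open>i < length ms\<close>] by (auto simp: comps_def Suc_le_eq)
    show "(case (sum_list (take i ms) + sum_list (drop (Suc i) ms), sum_list (take i ms), take i ms, drop (Suc i) ms)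
      of (N, a, as, bs) \<Rightarrow> as @ [M - N] @ bs) = ms"
      using eq s by simp
    show "(sum_list (take i ms) + sum_list (drop (Suc i) ms), sum_list (take i ms), take i ms, drop (Suc i) ms) \<in> ?S"
      using ms s p assms by (auto simp del: neq0_conv simp: comps_def dest: in_set_takeD in_set_dropD)
  qed (use assms in \<open>auto simp: comps_def\<close>)
  also have "\<dots> = (\<Sum>N<M. \<Sum>(a, as, bs)\<in>(SIGMA a:{0..N}. comps i a \<times> comps (r - i) (N - a)). F as * G bs)"
    by (subst sum.Sigma) (auto simp: finite_comps)
  also have "\<dots> = (\<Sum>N<M. \<Sum>a=0..N. \<Sum>(as, bs)\<in>comps i a \<times> comps (r - i) (N - a). F as * G bs)"
    by (subst sum.Sigma) (auto simp: finite_comps)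
  finally show ?thesis by (simp add: sum_product sum.cartesian_product)
qed

lemma sum_comps_rev: "(\<Sum>bs\<in>comps q b. G bs) = (\<Sum>bs\<in>comps q b. G (rev bs))"
  by (rule sum.reindex_bij_witness[of _ rev rev]) (auto simp: comps_def)

lemma prod_lessThan_add:
  fixes f :: "nat \<Rightarrow> 'a::comm_monoid_mult"
  shows "(\<Prod>j<i + q. f j) = (\<Prod>j<i. f j) * (\<Prod>j<q. f (i + j))"
  by (induction q) (auto simp: mult.assoc)

text \<open>The linear tree with its root moved from the last vertex to vertex i, counted from 0.
  Edge j joins vertices j and j + 1, so exactly the edges with i <= j lie between the two
  roots.\<close>

definition line_series :: "nat list \<Rightarrow> nat \<Rightarrow> nat \<Rightarrow> rat fps" where
  "line_series ks M i = (\<Sum>ms\<in>comps (Suc (length ks)) M. \<Prod>j<length ks.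
     inverse (if i \<le> j then fps_X - fps_const (of_nat (sum_list (drop (Suc j) ms)))
              else fps_const (of_nat (sum_list (take (Suc j) ms)))) ^ (ks ! j))"

text \<open>The edges before the new root form the first shuffle factor. The edges behind it, read
  from the far end, form the reversed second factor, so this is the i-th summand of Z_M of the
  symmetrization.\<close>

lemma line_series_nth:
  assumes "pos_idx ks" "i \<le> length ks"
  shows "line_series ks M i $ n = (\<Sum>ls\<in>weaks (length ks - i) n.
         (-1) ^ (sum_list (drop i ks)) * of_nat (bprod (drop i ks) ls)
         * (\<Sum>N<M. (Lir (rev (zw (take i ks))) * Lir (rev (zw (rev (map2 (+) (drop i ks) ls))))) $ N))"
proof -
  let ?r = "length ks"
  define q where "q = ?r - i"
  define ds where "ds = drop i ks"
  have r: "?r = i + q" and lds: "length ds = q" using assms(2) by (simp_all add: q_def ds_def)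
  define F where "F as = (\<Prod>j<i. inverse (fps_const (of_nat (sum_list (take (Suc j) as))) :: rat fps) ^ (ks ! j))" for as :: "nat list"
  define G where "G bs = (\<Prod>j<q. shift_pow (ds ! j) (sum_list (drop j bs)))" for bs :: "nat list"
  have "line_series ks M i = (\<Sum>ms\<in>comps (Suc ?r) M. F (take i ms) * G (drop (Suc i) ms))"
    unfolding line_series_def
    by (rule sum.cong[OF refl])
      (simp add: r prod_lessThan_add F_def G_def shift_pow_def min_def ds_def add.commute)
  also have "\<dots> = (\<Sum>N<M. \<Sum>a=0..N. (\<Sum>as\<in>comps i a. F as) * (\<Sum>bs\<in>comps q (N - a). G bs))"
    unfolding q_def by (rule sum_comps_split[OF assms(2)])
  also have "\<dots> = (\<Sum>N<M. \<Sum>a=0..N. fps_const (Lir (rev (zw (take i ks))) $ a) * nested_sum (map shift_pow (rev ds)) (N - a))"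
  proof (intro sum.cong refl arg_cong2[of _ _ _ _ "(*)"])
    fix N a
    have "pos_idx (take i ks)" using assms(1) by (auto simp: pos_idx_def dest: in_set_takeD)
    then have "Lir (rev (zw (take i ks))) $ a = (\<Sum>as\<in>comps i a. \<Prod>j<i. inv_pow (ks ! j) (sum_list (take (Suc j) as)))"
      using assms(2) by (simp add: Lir_zw_nth nested_sum_def min_def)
    moreover have "fps_const (sum f A) = (\<Sum>x\<in>A. fps_const (f x))" for f :: "nat list \<Rightarrow> rat" and A
      by (induction A rule: infinite_finite_induct) (auto simp: fps_const_add[symmetric] simp del: fps_const_add)
    moreover have "fps_const (prod f A) = (\<Prod>x\<in>A. fps_const (f x))" for f :: "nat \<Rightarrow> rat" and A
      by (induction A rule: infinite_finite_induct) (auto simp: fps_const_mult[symmetric] simp del: fps_const_mult)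
    ultimately show "(\<Sum>as\<in>comps i a. F as) = fps_const (Lir (rev (zw (take i ks))) $ a)"
      by (simp add: F_def fps_const_inverse inverse_eq_divide)
    have "(\<Sum>bs\<in>comps q (N - a). G bs) = (\<Sum>bs\<in>comps q (N - a). G (rev bs))"
      by (rule sum_comps_rev)
    also have "\<dots> = nested_sum (map shift_pow (rev ds)) (N - a)"
      unfolding nested_sum_def
    proof (rule sum.cong)
      fix bs assume "bs \<in> comps (length (map shift_pow (rev ds))) (N - a)"
      then have bs: "length bs = q" by (simp add: comps_def lds)
      have "G (rev bs) = (\<Prod>j<q. shift_pow (ds ! j) (sum_list (take (q - j) bs)))"
        by (simp add: G_def drop_rev bs)
      also have "\<dots> = (\<Prod>j<q. shift_pow (ds ! (q - Suc j)) (sum_list (take (q - (q - Suc j)) bs)))"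
        by (rule prod.nat_diff_reindex[symmetric])
      also have "\<dots> = (\<Prod>j<length (map shift_pow (rev ds)). (map shift_pow (rev ds) ! j) (sum_list (take (Suc j) bs)))"
        by (rule prod.cong) (auto simp: lds rev_nth)
      finally show "G (rev bs) = (\<Prod>j<length (map shift_pow (rev ds)). (map shift_pow (rev ds) ! j) (sum_list (take (Suc j) bs)))" .
    qed (simp add: lds)
    finally show "(\<Sum>bs\<in>comps q (N - a). G bs) = nested_sum (map shift_pow (rev ds)) (N - a)" .
  qed
  finally have "line_series ks M i $ n = (\<Sum>N<M. \<Sum>a=0..N. Lir (rev (zw (take i ks))) $ a *
      (\<Sum>ls\<in>weaks q n. (-1) ^ sum_list ds * of_nat (bprod ds ls) * nested_sum (map inv_pow (rev (map2 (+) ds ls))) (N - a)))"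
    by (simp add: fps_sum_nth nested_sum_shift_nth lds)
  also have "\<dots> = (\<Sum>N<M. \<Sum>a=0..N. \<Sum>ls\<in>weaks q n. (-1) ^ sum_list ds * of_nat (bprod ds ls) *
     (Lir (rev (zw (take i ks))) $ a * Lir (rev (zw (rev (map2 (+) ds ls)))) $ (N - a)))"
  proof -
    have "Lir (rev (zw (rev (map2 (+) ds ls)))) $ b = nested_sum (map inv_pow (rev (map2 (+) ds ls))) b" for ls b
    proof (rule Lir_zw_nth)
      have "\<forall>d\<in>set ds. 0 < d" using assms(1) by (auto simp: pos_idx_def ds_def dest: in_set_dropD)
      then show "pos_idx (rev (map2 (+) ds ls))" by (auto simp: pos_idx_def dest: set_zip_leftD)
    qed
    then show ?thesis by (simp add: sum_distrib_left ac_simps)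
  qed
  also have "\<dots> = (\<Sum>ls\<in>weaks q n. \<Sum>N<M. \<Sum>a=0..N. (-1) ^ sum_list ds * of_nat (bprod ds ls) *
     (Lir (rev (zw (take i ks))) $ a * Lir (rev (zw (rev (map2 (+) ds ls)))) $ (N - a)))"
    by (simp add: sum.swap[of _ _ "weaks q n"])
  finally show ?thesis by (simp add: fps_mult_nth sum_distrib_left q_def ds_def)
qed

lemma Zmap_phihat_idx_line:
  assumes "pos_idx ks" "M \<ge> 1"
  shows "Zmap M (phihat_idx ks n) = (\<Sum>i\<in>{0..length ks}. line_series ks M i $ n)"
  unfolding Zmap_phihat_idx[OF assms(2)]
  by (rule sum.cong[OF refl]) (simp add: line_series_nth[OF assms(1)] weaks_def)

lemma Zword_line:
  assumes "pos_idx ks"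
  shows "Zword M (zw ks) = line_series ks M (length ks) $ 0"
proof -
  have "weaks 0 0 = {[]}" by (auto simp: weaks_def)
  then show ?thesis using line_series_nth[OF assms, of "length ks" M 0]
    by (simp add: bprod_def zw_Nil Zword_def)
qed

section \<open>Laminar families\<close>

definition wts :: "'v set \<Rightarrow> nat \<Rightarrow> ('v \<Rightarrow> nat) set" where
  "wts W M = {m. (\<forall>v\<in>W. 1 \<le> m v) \<and> (\<forall>v. v \<notin> W \<longrightarrow> m v = 0) \<and> sum m W = M}"

text \<open>\<open>side W v m B\<close> is the sum of \<open>m\<close> over \<open>B\<close>; if \<open>v \<in> B\<close> it is rewritten through the
  complement, with the total weight replaced by the variable \<open>t\<close>.\<close>

definition side :: "'v set \<Rightarrow> 'v \<Rightarrow> ('v \<Rightarrow> nat) \<Rightarrow> 'v set \<Rightarrow> rat fps" where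
  "side W v m B = (if v \<in> B then fps_X - fps_const (of_nat (sum m (W - B))) else fps_const (of_nat (sum m B)))"

text \<open>The multiplicity of a set is its exponent, so a partial fraction step exchanges a single
  copy.\<close>

definition laminar_series :: "'v set \<Rightarrow> nat \<Rightarrow> 'v \<Rightarrow> 'v set multiset \<Rightarrow> rat fps" where
  "laminar_series W M v K = (\<Sum>m\<in>wts W M. \<Prod>B\<in>#K. inverse (side W v m B))"

definition separating_laminar :: "'v set \<Rightarrow> 'v \<Rightarrow> 'v set multiset \<Rightarrow> bool" where
  "separating_laminar W r K \<longleftrightarrow> finite W \<and> r \<in> W \<and> (\<forall>B\<in>#K. B \<subseteq> W \<and> B \<noteq> {} \<and> r \<notin> B)
     \<and> (\<forall>A\<in>#K. \<forall>B\<in>#K. A \<subseteq> B \<or> B \<subseteq> A \<or> A \<inter> B = {})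
     \<and> (\<forall>v\<in>W. \<forall>v'\<in>W. v \<noteq> v' \<longrightarrow> (\<exists>B\<in>#K. (v \<in> B) \<noteq> (v' \<in> B)))"

lemma separating_laminarD:
  assumes "separating_laminar W r K"
  shows "finite W" "r \<in> W" "D \<in># K \<Longrightarrow> D \<subseteq> W \<and> D \<noteq> {} \<and> r \<notin> D"
    "C \<in># K \<Longrightarrow> D \<in># K \<Longrightarrow> C \<subseteq> D \<or> D \<subseteq> C \<or> C \<inter> D = {}"
    "v \<in> W \<Longrightarrow> v' \<in> W \<Longrightarrow> v \<noteq> v' \<Longrightarrow> \<exists>D\<in>#K. (v \<in> D) \<noteq> (v' \<in> D)"
  using assms by (simp_all add: separating_laminar_def)

text \<open>The element is chosen before M and n: one w has to satisfy both formulas for all of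
  them. This makes the property stable under addition of families' series.\<close>

definition realizable :: "'v set \<Rightarrow> 'v \<Rightarrow> 'v set multiset \<Rightarrow> bool" where
  "realizable W r K \<longleftrightarrow> (\<exists>w. in_H1 w \<and> (\<forall>M\<ge>1. Zmap M w = laminar_series W M r K $ 0
     \<and> (\<forall>n. Zmap M (phihat w n) = (\<Sum>v\<in>W. laminar_series W M v K $ n))))"

text \<open>At most one of the disjoint sets contains v. If it is A, then W - A splits into B and
  the complement of the union, so adding the weight of B leaves t minus the weight of that
  complement.\<close>

lemma side_add:
  assumes "finite W" "A \<subseteq> W" "B \<subseteq> W" "A \<inter> B = {}"
  shows "side W v m A + side W v m B = side W v m (A \<union> B)"
proof -
  have fin: "finite A" "finite B" using assms finite_subset by blast+
  have 0: "sum m (A \<union> B) = sum m A + sum m B" by (rule sum.union_disjoint) (use fin assms in auto)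
  have diff: "sum m (W - C) = sum m (W - (C \<union> D)) + sum m D" if "D \<subseteq> W" "C \<inter> D = {}" "finite D" for C D
  proof -
    have "W - C = (W - (C \<union> D)) \<union> D" using that by auto
    moreover have "sum m ((W - (C \<union> D)) \<union> D) = sum m (W - (C \<union> D)) + sum m D"
      using that assms(1) by (intro sum.union_disjoint) auto
    ultimately show ?thesis by simp
  qed
  have "sum m (W - A) = sum m (W - (A \<union> B)) + sum m B" "sum m (W - B) = sum m (W - (A \<union> B)) + sum m A"
    using diff[of B A] diff[of A B] assms fin by (simp_all add: Un_commute Int_commute)
  then show ?thesis using 0 assms(4)
    by (auto simp: side_def algebra_simps fps_const_add[symmetric] simp del: fps_const_add)
qed

text \<open>Both B and its complement, which contains r, are nonempty and carry positive weights. So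
  every \<open>side\<close> is an invertible power series.\<close>

lemma side_nth_0:
  assumes "finite W" "m \<in> wts W M" "B \<subseteq> W" "B \<noteq> {}" "r \<in> W" "r \<notin> B"
  shows "side W v m B $ 0 \<noteq> 0"
proof -
  have pos: "sum m C \<noteq> 0" if "C \<subseteq> W" "C \<noteq> {}" for C
    using that assms(1,2) finite_subset[of C W] by (fastforce simp: wts_def)
  have "sum m (W - B) \<noteq> 0" "sum m B \<noteq> 0" using pos[of "W - B"] pos[of B] assms(3-6) by blast+
  then show ?thesis by (simp add: side_def del: sum_eq_0_iff of_nat_sum)
qed

lemma laminar_series_split:
  assumes "separating_laminar W r (add_mset A (add_mset B K))" "A \<inter> B = {}"
  shows "laminar_series W M v (add_mset A (add_mset B K))
    = laminar_series W M v (add_mset (A \<union> B) (add_mset B K)) + laminar_series W M v (add_mset (A \<union> B) (add_mset A K))"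
proof -
  have W: "finite W" "r \<in> W" "A \<subseteq> W" "B \<subseteq> W" "A \<noteq> {}" "B \<noteq> {}" "r \<notin> A" "r \<notin> B"
    using assms(1) by (auto simp: separating_laminar_def)
  show ?thesis unfolding laminar_series_def sum.distrib[symmetric]
  proof (rule sum.cong[OF refl])
    fix m assume m: "m \<in> wts W M"
    let ?a = "side W v m A" and ?b = "side W v m B" and ?c = "side W v m (A \<union> B)"
    have nz: "?a $ 0 \<noteq> 0" "?b $ 0 \<noteq> 0" "?c $ 0 \<noteq> 0"
      using side_nth_0[OF W(1) m, of A r v] side_nth_0[OF W(1) m, of B r v] side_nth_0[OF W(1) m, of "A \<union> B" r v] W by auto
    have "inverse ?c * inverse ?b + inverse ?c * inverse ?a
      = inverse ?c * ((?a * inverse ?a) * inverse ?b + (?b * inverse ?b) * inverse ?a)"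
      using nz by (simp add: inverse_mult_eq_1' algebra_simps)
    also have "\<dots> = inverse ?c * (?a + ?b) * (inverse ?a * inverse ?b)"
      by (simp add: algebra_simps)
    also have "inverse ?c * (?a + ?b) = 1"
      unfolding side_add[OF W(1,3,4) assms(2)] using nz(3) by (rule inverse_mult_eq_1)
    finally have "inverse ?a * inverse ?b = inverse ?c * inverse ?b + inverse ?c * inverse ?a" by simp
    then have "inverse ?a * (inverse ?b * Q) = inverse ?c * (inverse ?b * Q) + inverse ?c * (inverse ?a * Q)" for Q
      by (simp add: mult.assoc[symmetric] distrib_right[symmetric])
    then show "(\<Prod>B\<in>#add_mset A (add_mset B K). inverse (side W v m B)) =
        (\<Prod>B\<in>#add_mset (A \<union> B) (add_mset B K). inverse (side W v m B)) +
        (\<Prod>B\<in>#add_mset (A \<union> B) (add_mset A K). inverse (side W v m B))"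
      by simp
  qed
qed

lemma realizable_split:
  assumes "separating_laminar W r (add_mset A (add_mset B K))" "A \<inter> B = {}"
    "realizable W r (add_mset (A \<union> B) (add_mset B K))" "realizable W r (add_mset (A \<union> B) (add_mset A K))"
  shows "realizable W r (add_mset A (add_mset B K))"
proof -
  obtain p where p: "in_H1 p" and p0: "\<And>M. M \<ge> 1 \<Longrightarrow> Zmap M p = laminar_series W M r (add_mset (A \<union> B) (add_mset B K)) $ 0"
    and pn: "\<And>M n. M \<ge> 1 \<Longrightarrow> Zmap M (phihat p n) = (\<Sum>v\<in>W. laminar_series W M v (add_mset (A \<union> B) (add_mset B K)) $ n)"
    using assms(3) unfolding realizable_def by blast
  obtain q where q: "in_H1 q" and q0: "\<And>M. M \<ge> 1 \<Longrightarrow> Zmap M q = laminar_series W M r (add_mset (A \<union> B) (add_mset A K)) $ 0"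
    and qn: "\<And>M n. M \<ge> 1 \<Longrightarrow> Zmap M (phihat q n) = (\<Sum>v\<in>W. laminar_series W M v (add_mset (A \<union> B) (add_mset A K)) $ n)"
    using assms(4) unfolding realizable_def by blast
  show ?thesis
    unfolding realizable_def laminar_series_split[OF assms(1,2)]
    by (rule exI[of _ "\<lambda>u. p u + q u"])
      (simp add: in_H1_add p q Zmap_add phihat_add in_H1_phihat p0 q0 pn qn sum.distrib)
qed

text \<open>Merging an arbitrary disjoint pair could break laminarity; maximal total size forces
  every member strictly above A or B to contain both. Separation survives the loss of A because A is
  the difference of the union and B.\<close>

lemma separating_laminar_merge:
  assumes "separating_laminar W r (add_mset A (add_mset B K))" "A \<inter> B = {}"
    and max: "\<And>C D. C \<in># add_mset A (add_mset B K) \<Longrightarrow> D \<in># add_mset A (add_mset B K) \<Longrightarrow> C \<inter> D = {}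
      \<Longrightarrow> card C + card D \<le> card A + card B"
  shows "separating_laminar W r (add_mset (A \<union> B) (add_mset B K))"
proof -
  let ?L = "add_mset A (add_mset B K)" and ?L' = "add_mset (A \<union> B) (add_mset B K)"
  note fin = separating_laminarD(1)[OF assms(1)] and r = separating_laminarD(2)[OF assms(1)]
    and sets = separating_laminarD(3)[OF assms(1)] and lam = separating_laminarD(4)[OF assms(1)]
    and sep = separating_laminarD(5)[OF assms(1)]
  \<comment> \<open>Applied to (A, B) and to (B, A). If D were disjoint from D', the two would form
    a disjoint pair of larger total size; so they meet, and laminarity leaves only one
    inclusion.\<close>
  have grow: "D' \<subseteq> D" if "D \<in># ?L" "C \<in># ?L" "D' \<in># ?L" "card C + card D' = card A + card B" "C \<subset> D" "C \<inter> D' = {}" for C D D'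
  proof -
    have "finite D" using sets[OF that(1)] fin finite_subset by blast
    then have "card C < card D" using that(5) by (rule psubset_card_mono)
    then have "D \<inter> D' \<noteq> {}" using max[OF that(1,3)] that(4) by fastforce
    moreover have "\<not> D \<subseteq> D'" using that(5,6) sets[OF that(2)] by blast
    ultimately show ?thesis using lam[OF that(1,3)] by blast
  qed
  have new: "D \<subseteq> A \<union> B \<or> A \<union> B \<subseteq> D \<or> D \<inter> (A \<union> B) = {}" if D: "D \<in># ?L" for D
  proof -
    have "A \<subset> D \<Longrightarrow> B \<subseteq> D" "B \<subset> D \<Longrightarrow> A \<subseteq> D"
      using grow[of D A B] grow[of D B A] D assms(2) by auto
    then show ?thesis using lam[OF D, of A] lam[OF D, of B] by auto
  qed
  have "C \<subseteq> D \<or> D \<subseteq> C \<or> C \<inter> D = {}" if "C \<in># ?L'" "D \<in># ?L'" for C D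
  proof -
    have "C = A \<union> B \<or> C \<in># ?L" "D = A \<union> B \<or> D \<in># ?L" using that by auto
    then show ?thesis using new[of C] new[of D] lam[of C D] by blast
  qed
  moreover have "D \<subseteq> W \<and> D \<noteq> {} \<and> r \<notin> D" if "D \<in># ?L'" for D
    using that sets[of A] sets[of B] sets[of D] by auto
  moreover have "\<exists>D\<in>#?L'. (v \<in> D) \<noteq> (v' \<in> D)" if vv: "v \<in> W" "v' \<in> W" "v \<noteq> v'" for v v'
  proof -
    obtain D where D: "D \<in># ?L" "(v \<in> D) \<noteq> (v' \<in> D)" using sep[OF vv] by blast
    show ?thesis
    proof (cases "D = A")
      case True
      then have "(v \<in> A \<union> B) \<noteq> (v' \<in> A \<union> B) \<or> (v \<in> B) \<noteq> (v' \<in> B)" using D(2) assms(2) by auto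
      then show ?thesis by auto
    next
      case False
      then have "D \<in># ?L'" using D(1) by auto
      then show ?thesis using D(2) by blast
    qed
  qed
  ultimately show ?thesis unfolding separating_laminar_def using fin r
    by (intro conjI ballI impI) simp_all
qed

lemma chain_max:
  assumes "K \<noteq> {#}" "\<And>B. B \<in># K \<Longrightarrow> finite B" "\<And>A B. A \<in># K \<Longrightarrow> B \<in># K \<Longrightarrow> A \<subseteq> B \<or> B \<subseteq> A"
  shows "\<exists>C\<in>#K. \<forall>B\<in>#K. B \<subseteq> C"
proof -
  have "Max (card ` set_mset K) \<in> card ` set_mset K" using assms(1) by (intro Max_in) auto
  then obtain C where C: "C \<in># K" "card C = Max (card ` set_mset K)" by auto
  have "B \<subseteq> C" if "B \<in># K" for B
  proof -
    have "card B \<le> card C" unfolding C(2) using that by (intro Max_ge) auto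
    then show ?thesis using assms(3)[OF that C(1)] card_seteq[OF assms(2)[OF that], of C] by blast
  qed
  then show ?thesis using C(1) by blast
qed

text \<open>The family of a linear tree rooted at the last vertex: edge j cuts off the first j + 1
  vertices.\<close>

definition line_mset :: "'v list \<Rightarrow> nat list \<Rightarrow> 'v set multiset" where
  "line_mset vs ks = (\<Sum>j<length ks. replicate_mset (ks ! j) (set (take (Suc j) vs)))"

text \<open>Separation from r forces the largest member to be W without r. Its multiplicity is the
  last exponent, and the other members form a separating chain on this smaller set.\<close>

lemma chain_eq_line:
  assumes "separating_laminar W r K" "\<And>A B. A \<in># K \<Longrightarrow> B \<in># K \<Longrightarrow> A \<subseteq> B \<or> B \<subseteq> A"
  shows "\<exists>vs ks. distinct vs \<and> set vs = W \<and> last vs = r \<and> length vs = Suc (length ks) \<and> pos_idx ks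
    \<and> K = line_mset vs ks"
  using assms
proof (induction "card W" arbitrary: W r K rule: less_induct)
  case less
  note fin = separating_laminarD(1)[OF less.prems(1)] and r = separating_laminarD(2)[OF less.prems(1)]
    and sets = separating_laminarD(3)[OF less.prems(1)] and sep = separating_laminarD(5)[OF less.prems(1)]
  note chain = less.prems(2)
  have finD: "finite D" if "D \<in># K" for D using sets[OF that] fin finite_subset by blast
  show ?case
  proof (cases "W = {r}")
    case True
    have "D \<notin># K" for D using sets[of D] True by auto
    then have "K = {#}" by (meson multiset_nonemptyE)
    then show ?thesis using True
      by (intro exI[of _ "[r]"] exI[of _ "[]"]) (auto simp: pos_idx_def line_mset_def)
  next
    case False
    then obtain v where "v \<in> W" "v \<noteq> r" using r by blast
    then have "K \<noteq> {#}" using sep[of v r] r by auto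
    then have "\<exists>C\<in>#K. \<forall>B\<in>#K. B \<subseteq> C"
      by (rule chain_max) (simp_all add: finD chain)
    then obtain C where C: "C \<in># K" and Cmax: "\<And>B. B \<in># K \<Longrightarrow> B \<subseteq> C" by blast
    have CW: "C = W - {r}"
    proof
      show "C \<subseteq> W - {r}" using sets[OF C] by auto
      show "W - {r} \<subseteq> C"
      proof
        fix v assume "v \<in> W - {r}"
        then obtain D where "D \<in># K" "(v \<in> D) \<noteq> (r \<in> D)" using sep[of v r] r by auto
        then show "v \<in> C" using Cmax sets by blast
      qed
    qed
    define K' where "K' = filter_mset (\<lambda>B. B \<noteq> C) K"
    have K: "K = K' + replicate_mset (count K C) C"
      by (rule multiset_eqI) (auto simp: K'_def)
    have K'sub: "B \<in># K \<and> B \<subset> C" if "B \<in># K'" for B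
      using that Cmax[of B] by (auto simp: K'_def)
    \<comment> \<open>The smaller chain needs a root: the largest remaining member is a proper
      subset of C, and a point of C outside it lies in no remaining member.\<close>
    have "\<exists>r'\<in>C. \<forall>B\<in>#K'. r' \<notin> B"
    proof (cases "K' = {#}")
      case True
      then show ?thesis using sets[OF C] by auto
    next
      case False
      have "\<exists>C'\<in>#K'. \<forall>B\<in>#K'. B \<subseteq> C'"
        by (rule chain_max[OF False]) (simp_all add: finD chain K'sub)
      then obtain C' where C': "C' \<in># K'" "\<forall>B\<in>#K'. B \<subseteq> C'" by blast
      obtain r' where "r' \<in> C" "r' \<notin> C'" using K'sub[OF C'(1)] by blast
      then show ?thesis using C'(2) by blast
    qed
    then obtain r' where r': "r' \<in> C" "\<And>B. B \<in># K' \<Longrightarrow> r' \<notin> B" by blast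
    have "separating_laminar C r' K'"
      unfolding separating_laminar_def
    proof (intro conjI ballI impI)
      fix v v' assume vv: "v \<in> C" "v' \<in> C" "v \<noteq> v'"
      then obtain D where D: "D \<in># K" "(v \<in> D) \<noteq> (v' \<in> D)" using sep[of v v'] CW by auto
      then have "D \<noteq> C" using vv by auto
      then show "\<exists>B\<in>#K'. (v \<in> B) \<noteq> (v' \<in> B)" using D by (auto simp: K'_def)
    next
      fix A B assume "A \<in># K'" "B \<in># K'"
      then show "A \<subseteq> B \<or> B \<subseteq> A \<or> A \<inter> B = {}" using chain[of A B] K'sub by blast
    next
      fix B assume B: "B \<in># K'"
      show "B \<subseteq> C" "B \<noteq> {}" "r' \<notin> B" using K'sub[OF B] sets[of B] r'(2)[OF B] by auto
    qed (use r' finD[OF C] in auto)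
    moreover have "card C < card W" using CW fin r by (metis card_Diff1_less)
    ultimately obtain vs ks where vs: "distinct vs" "set vs = C" "length vs = Suc (length ks)" "pos_idx ks"
      "K' = line_mset vs ks"
      using less.hyps[of C r' K'] chain K'sub by metis
    have "K' = (\<Sum>j<length ks. replicate_mset (ks ! j) (set (take (Suc j) (vs @ [r]))))"
      unfolding vs(5) line_mset_def by (rule sum.cong) (auto simp: vs(3))
    moreover have "set (take (Suc (length ks)) (vs @ [r])) = C" using vs by simp
    ultimately have "K = line_mset (vs @ [r]) (ks @ [count K C])"
      by (subst K) (simp add: line_mset_def nth_append)
    moreover have "pos_idx (ks @ [count K C])" using vs(4) C by (auto simp: pos_idx_def)
    ultimately show ?thesis using vs CW r
      by (intro exI[of _ "vs @ [r]"] exI[of _ "ks @ [count K C]"]) auto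
  qed
qed

lemma prod_mset_sum_replicate:
  fixes f :: "'b \<Rightarrow> 'c::comm_monoid_mult"
  shows "(\<Prod>B\<in>#(\<Sum>a\<in>A. replicate_mset (k a) (S a)). f B) = (\<Prod>a\<in>A. f (S a) ^ k a)"
  by (induction A rule: infinite_finite_induct) auto

lemma sum_wts_eq_sum_comps:
  assumes "distinct vs" "set vs = W"
  shows "(\<Sum>m\<in>wts W M. H (map m vs)) = (\<Sum>ms\<in>comps (length vs) M. H ms)"
proof (rule sum.reindex_bij_betw)
  have inj: "inj_on ((!) vs) {..<length vs}" using assms(1) by (auto intro: inj_on_nth)
  show "bij_betw (\<lambda>m. map m vs) (wts W M) (comps (length vs) M)"
  proof (rule bij_betwI')
    fix m m' assume "m \<in> wts W M" "m' \<in> wts W M"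
    moreover have "m = m'" if "\<forall>v\<in>W. m v = m' v" "m \<in> wts W M" "m' \<in> wts W M"
    proof
      fix v show "m v = m' v" using that by (cases "v \<in> W") (auto simp: wts_def)
    qed
    ultimately show "(map m vs = map m' vs) = (m = m')" using assms(2) by (auto simp: map_eq_conv)
  next
    fix m assume "m \<in> wts W M"
    then show "map m vs \<in> comps (length vs) M"
      using assms by (auto simp: wts_def comps_def sum_list_distinct_conv_sum_set)
  next
    fix ms assume ms: "ms \<in> comps (length vs) M"
    define m where "m v = (if v \<in> W then ms ! the_inv_into {..<length vs} ((!) vs) v else 0)" for v
    have m: "m (vs ! i) = ms ! i" if "i < length vs" for i
      using that assms(2) the_inv_into_f_f[OF inj, of i] by (auto simp: m_def)
    have map: "map m vs = ms" using ms by (intro nth_equalityI) (auto simp: m comps_def)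
    have "sum m W = sum_list (map m vs)" using assms by (simp add: sum_list_distinct_conv_sum_set)
    then have "sum m W = M" using ms map by (simp add: comps_def)
    moreover have "1 \<le> m v" if "v \<in> W" for v
    proof -
      have "m v \<in> set (map m vs)" using that assms(2) by auto
      then show ?thesis using ms unfolding map by (auto simp: comps_def)
    qed
    ultimately have "m \<in> wts W M" by (auto simp: wts_def m_def)
    then show "\<exists>m\<in>wts W M. ms = map m vs" using map by blast
  qed
qed

lemma laminar_series_line:
  assumes "distinct vs" "set vs = W" "length vs = Suc (length ks)" "i \<le> length ks"
  shows "laminar_series W M (vs ! i) (line_mset vs ks) = line_series ks M i"
proof -
  have "laminar_series W M (vs ! i) (line_mset vs ks) = (\<Sum>m\<in>wts W M. \<Prod>j<length ks.
     inverse (if i \<le> j then fps_X - fps_const (of_nat (sum_list (drop (Suc j) (map m vs))))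
              else fps_const (of_nat (sum_list (take (Suc j) (map m vs))))) ^ (ks ! j))"
    unfolding laminar_series_def line_mset_def prod_mset_sum_replicate
  proof (intro sum.cong prod.cong refl)
    fix m :: "'a \<Rightarrow> nat" and j assume "j \<in> {..<length ks}"
    then have j: "j < length ks" by simp
    have mem: "vs ! i \<in> set (take (Suc j) vs) \<longleftrightarrow> i \<le> j"
    proof
      assume "vs ! i \<in> set (take (Suc j) vs)"
      then obtain i' where i': "i' < Suc j" "vs ! i' = vs ! i" "i' < length vs"
        using j assms(3) by (auto simp: in_set_conv_nth)
      then have "i' = i" using assms by (auto simp: nth_eq_iff_index_eq)
      then show "i \<le> j" using i' by simp
    next
      assume "i \<le> j"
      then show "vs ! i \<in> set (take (Suc j) vs)"
        using j assms(3) by (auto simp: in_set_conv_nth intro!: exI[of _ i])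
    qed
    have "sum m (set (take (Suc j) vs)) = sum_list (take (Suc j) (map m vs))"
      using assms(1) by (simp add: sum_list_distinct_conv_sum_set take_map)
    moreover have "W - set (take (Suc j) vs) = set (drop (Suc j) vs)"
    proof -
      have "set vs = set (take (Suc j) vs) \<union> set (drop (Suc j) vs)"
        by (metis append_take_drop_id set_append)
      moreover have "set (take (Suc j) vs) \<inter> set (drop (Suc j) vs) = {}"
        using assms(1) by (simp add: set_take_disj_set_drop_if_distinct)
      ultimately show ?thesis using assms(2) by auto
    qed
    then have "sum m (W - set (take (Suc j) vs)) = sum_list (drop (Suc j) (map m vs))"
      using assms(1) by (simp add: sum_list_distinct_conv_sum_set drop_map)
    ultimately show "inverse (side W (vs ! i) m (set (take (Suc j) vs))) ^ (ks ! j) =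
         inverse (if i \<le> j then fps_X - fps_const (of_nat (sum_list (drop (Suc j) (map m vs))))
              else fps_const (of_nat (sum_list (take (Suc j) (map m vs))))) ^ (ks ! j)"
      unfolding side_def mem by simp
  qed
  also have "\<dots> = line_series ks M i"
    unfolding line_series_def assms(3)[symmetric] by (rule sum_wts_eq_sum_comps[OF assms(1,2)])
  finally show ?thesis .
qed

lemma realizable_line:
  assumes "distinct vs" "set vs = W" "length vs = Suc (length ks)" "last vs = r" "pos_idx ks"
  shows "realizable W r (line_mset vs ks)"
proof -
  have r: "r = vs ! length ks" using assms(3,4) by (metis diff_Suc_1 last_conv_nth length_0_conv nat.distinct(1))
  have "(\<Sum>v\<in>W. laminar_series W M v (line_mset vs ks) $ n) = (\<Sum>i\<in>{0..length ks}. line_series ks M i $ n)" for M n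
  proof -
    have "bij_betw ((!) vs) {0..length ks} W"
      using bij_betw_nth[OF assms(1) refl assms(2)[symmetric]] assms(3)
      by (metis atLeast0AtMost lessThan_Suc_atMost)
    then have "(\<Sum>v\<in>W. laminar_series W M v (line_mset vs ks) $ n)
        = (\<Sum>i\<in>{0..length ks}. laminar_series W M (vs ! i) (line_mset vs ks) $ n)"
      by (rule sum.reindex_bij_betw[symmetric])
    then show ?thesis by (simp add: laminar_series_line[OF assms(1-3)])
  qed
  then show ?thesis
    unfolding realizable_def
    by (intro exI[of _ "single (zw ks)"])
      (auto simp: in_H1_single H1_word_zw Zmap_single Zword_line[OF assms(5)] phihat_single[OF assms(5)]
        Zmap_phihat_idx_line[OF assms(5)] r laminar_series_line[OF assms(1-3)])
qed

text \<open>Since \<open>1 / (a b) = (1 / a + 1 / b) / (a + b)\<close>, two maximal disjoint members of the family can be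
  merged; iterating this ends in chains, for which the claim is the definition of \<open>phihat\<close>.\<close>

theorem separating_laminar_realizable:
  assumes "separating_laminar W r K"
  shows "realizable W r K"
  using assms
\<comment> \<open>The measure drops because A or B is replaced by their union, which is larger since
  both are nonempty.\<close>
proof (induction "\<Sum>B\<in>#K. card W - card B" arbitrary: K rule: less_induct)
  case less
  let ?D = "{(A, B). A \<in># K \<and> B \<in># K \<and> A \<inter> B = {}}"
  note W = separating_laminarD(1,2)[OF less.prems] and sets = separating_laminarD(3)[OF less.prems]
    and lam = separating_laminarD(4)[OF less.prems]
  show ?case
  proof (cases "?D = {}")
    case True
    then have "A \<subseteq> B \<or> B \<subseteq> A" if "A \<in># K" "B \<in># K" for A B using lam[OF that] that by blast
    with less.prems obtain vs ks where "distinct vs" "set vs = W" "last vs = r" "length vs = Suc (length ks)"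
      "pos_idx ks" "K = line_mset vs ks"
      using chain_eq_line[of W r K] by blast
    then show ?thesis using realizable_line[of vs W ks r] by simp
  next
    case False
    let ?f = "\<lambda>(A, B). card A + card B"
    have finD: "finite ?D" by (rule finite_subset[of _ "set_mset K \<times> set_mset K"]) auto
    have "Max (?f ` ?D) \<in> ?f ` ?D" using False finD by (intro Max_in) auto
    then obtain A B where AB: "(A, B) \<in> ?D" and mAB: "card A + card B = Max (?f ` ?D)" by auto
    have max: "card C + card D \<le> card A + card B" if "C \<in># K" "D \<in># K" "C \<inter> D = {}" for C D
      unfolding mAB using that finD by (intro Max_ge) (auto intro!: image_eqI[of _ _ "(C, D)"])
    have A: "A \<in># K" "A \<subseteq> W" "A \<noteq> {}" and B: "B \<in># K" "B \<subseteq> W" "B \<noteq> {}" and dis: "A \<inter> B = {}"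
      using AB sets by auto
    have "A \<noteq> B" using dis A(3) by auto
    then obtain K' where K: "K = add_mset A (add_mset B K')"
      using A(1) B(1) by (metis insert_DiffM insert_noteq_member)
    then have K2: "K = add_mset B (add_mset A K')" by (simp add: add_mset_commute)
    have fin: "finite A" "finite B" using A(2) B(2) W(1) finite_subset by blast+
    have card: "card (A \<union> B) = card A + card B" "card (A \<union> B) \<le> card W" "card A > 0" "card B > 0"
      using fin dis card_mono[OF W(1), of "A \<union> B"] A(2,3) B(2,3) by (simp_all add: card_Un_disjoint card_gt_0_iff)
    have sl1: "separating_laminar W r (add_mset (A \<union> B) (add_mset B K'))"
      using less.prems dis max unfolding K by (rule separating_laminar_merge)
    have "separating_laminar W r (add_mset (B \<union> A) (add_mset A K'))"
      by (rule separating_laminar_merge[OF less.prems[unfolded K2]]) (use dis max K2 in \<open>auto simp: add.commute\<close>)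
    then have sl2: "separating_laminar W r (add_mset (A \<union> B) (add_mset A K'))" by (simp add: Un_commute)
    have "realizable W r (add_mset (A \<union> B) (add_mset B K'))"
      by (rule less.hyps[OF _ sl1]) (use card in \<open>simp add: K\<close>)
    moreover have "realizable W r (add_mset (A \<union> B) (add_mset A K'))"
      by (rule less.hyps[OF _ sl2]) (use card in \<open>simp add: K\<close>)
    ultimately show ?thesis
      unfolding K by (rule realizable_split[OF less.prems[unfolded K] dis])
  qed
qed

section \<open>Paths in trees\<close>

lemma path_edges_Nil: "path_edges [] = {}"
  by (simp add: path_edges_def)

lemma path_edges_single: "path_edges [a] = {}"
  by (simp add: path_edges_def)

lemma path_edges_Cons2: "path_edges (a # b # vs) = insert {a, b} (path_edges (b # vs))"
  by (simp add: path_edges_def)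

lemmas path_edges_simps = path_edges_Nil path_edges_single path_edges_Cons2

lemma path_edges_append: "path_edges (xs @ a # ys) = path_edges (xs @ [a]) \<union> path_edges (a # ys)"
proof (induction xs)
  case (Cons x xs)
  then show ?case by (cases xs) (auto simp: path_edges_simps)
qed (simp add: path_edges_simps)

lemma path_edges_snoc: "vs \<noteq> [] \<Longrightarrow> path_edges (vs @ [z]) = insert {last vs, z} (path_edges vs)"
proof (induction vs rule: rev_induct)
  case (snoc y vs)
  then show ?case using path_edges_append[of vs y "[z]"] by (simp add: path_edges_simps)
qed simp

lemma path_edges_middle: "{a, b} \<in> path_edges (xs @ a # b # ys)"
  by (subst path_edges_append) (simp add: path_edges_simps)

lemma path_edges_subset_set: "e \<in> path_edges vs \<Longrightarrow> e \<subseteq> set vs"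
  by (induction vs rule: induct_list012) (auto simp: path_edges_simps)

lemma path_edges_split:
  assumes "e \<in> path_edges vs"
  obtains xs a b ys where "vs = xs @ a # b # ys" "e = {a, b}"
  using assms
proof (induction vs arbitrary: thesis rule: induct_list012)
  case (3 x y zs)
  show ?case
  proof (cases "e = {x, y}")
    case True
    then show ?thesis using "3.prems"(1)[of "[]"] by simp
  next
    case False
    then have "e \<in> path_edges (y # zs)" using "3.prems"(2) by (simp add: path_edges_simps)
    then obtain xs a b ys where "y # zs = xs @ a # b # ys" "e = {a, b}" using "3.IH"(2) by blast
    then show ?thesis using "3.prems"(1)[of "x # xs" a b ys] by simp
  qed
qed (auto simp: path_edges_simps)

lemma simple_path_prefix: "simple_path E (xs @ ys) \<Longrightarrow> xs \<noteq> [] \<Longrightarrow> simple_path E xs"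
proof (cases ys)
  case (Cons y ys')
  assume *: "simple_path E (xs @ ys)" "xs \<noteq> []"
  then obtain zs z where "xs = zs @ [z]" by (metis rev_exhaust)
  then show ?thesis using * path_edges_append[of zs z ys] by (auto simp: simple_path_def)
qed simp

lemma simple_path_suffix: "simple_path E (xs @ ys) \<Longrightarrow> ys \<noteq> [] \<Longrightarrow> simple_path E ys"
proof (cases ys)
  case (Cons y ys')
  assume *: "simple_path E (xs @ ys)" "ys \<noteq> []"
  then show ?thesis using Cons path_edges_append[of xs y ys'] by (auto simp: simple_path_def)
qed simp

lemma simple_path_snoc:
  "simple_path E vs \<Longrightarrow> z \<notin> set vs \<Longrightarrow> {last vs, z} \<in> E \<Longrightarrow> simple_path E (vs @ [z])"
  by (auto simp: simple_path_def path_edges_snoc)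

lemma simple_path_edge: "{a, b} \<in> E \<Longrightarrow> a \<noteq> b \<Longrightarrow> simple_path E [a, b]"
  by (simp add: simple_path_def path_edges_simps)

context
  fixes V :: "'v set" and E :: "'v set set"
  assumes tree: "is_tree V E"
begin

lemma tree_finite: "finite V"
  using tree by (simp add: is_tree_def)

lemma tree_edge: "e \<in> E \<Longrightarrow> \<exists>a b. a \<in> V \<and> b \<in> V \<and> a \<noteq> b \<and> e = {a, b}"
  using tree by (simp add: is_tree_def)

lemma tree_finite_edges: "finite E"
  by (rule finite_subset[of _ "Pow V"]) (use tree_edge tree_finite in auto)

lemma tree_path: "a \<in> V \<Longrightarrow> b \<in> V \<Longrightarrow> \<exists>vs. simple_path E vs \<and> hd vs = a \<and> last vs = b"
  using tree by (simp add: is_tree_def)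

lemma tree_path_unique:
  "simple_path E vs \<Longrightarrow> simple_path E vs' \<Longrightarrow> hd vs = hd vs' \<Longrightarrow> last vs = last vs' \<Longrightarrow> vs = vs'"
  using tree unfolding is_tree_def by metis

lemma P_eq:
  assumes "simple_path E vs" "hd vs = a" "last vs = b"
  shows "P E a b = path_edges vs"
proof -
  have "(THE vs. simple_path E vs \<and> hd vs = a \<and> last vs = b) = vs"
    by (rule the_equality) (use assms tree_path_unique in auto)
  then show ?thesis by (simp add: P_def)
qed

text \<open>Otherwise the path from z and the edge would be two simple paths with the same
  ends.\<close>

lemma tree_path_edge_last:
  assumes "simple_path E (xs @ z # ys)" "ys \<noteq> []" "{z, last ys} \<in> E"
  shows "ys = [last ys]"
proof -
  have "simple_path E (z # ys)" using simple_path_suffix[OF assms(1)] by simp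
  moreover have "z \<noteq> last ys" using assms(1,2) by (auto simp: simple_path_def)
  then have "simple_path E [z, last ys]" by (rule simple_path_edge[OF assms(3)])
  ultimately have "z # ys = [z, last ys]"
    by (rule tree_path_unique) (use assms(2) in auto)
  then show ?thesis by simp
qed

text \<open>Either z is new and the path grows by the edge, or z already lies on the path. In the
  second case it is the last vertex but one, and the path shrinks by the edge.\<close>

lemma P_step:
  assumes "c \<in> V" "y \<in> V" "y \<noteq> z" "{y, z} \<in> E"
  shows "f \<in> P E c z \<longleftrightarrow> (f \<in> P E c y) \<noteq> (f = {y, z})"
proof -
  obtain vs where vs: "simple_path E vs" "hd vs = c" "last vs = y"
    using tree_path[OF assms(1,2)] by blast
  then have ne: "vs \<noteq> []" by (simp add: simple_path_def)
  have Py: "P E c y = path_edges vs" using vs by (rule P_eq)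
  show ?thesis
  proof (cases "z \<in> set vs")
    case False
    have "P E c z = path_edges (vs @ [z])"
      using simple_path_snoc[OF vs(1) False] assms(4) vs ne by (intro P_eq) auto
    then have "P E c z = insert {y, z} (P E c y)" using path_edges_snoc[OF ne] vs Py by simp
    moreover have "{y, z} \<notin> P E c y" using False path_edges_subset_set[of "{y, z}" vs] Py by auto
    ultimately show ?thesis by auto
  next
    case True
    then obtain xs ys where xy: "vs = xs @ z # ys" by (meson split_list)
    then have ys: "ys \<noteq> []" "last ys = y" using vs(3) assms(3) by auto
    have "ys = [y]"
      using tree_path_edge_last[of xs z ys] vs(1) xy ys assms(4) by (simp add: insert_commute)
    then have vs': "vs = (xs @ [z]) @ [y]" using xy by simp
    have "P E c z = path_edges (xs @ [z])"
    proof (rule P_eq)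
      show "simple_path E (xs @ [z])"
        using simple_path_prefix[of E "xs @ [z]" "[y]"] vs(1) vs' by simp
    qed (use vs xy in \<open>cases xs; auto\<close>)+
    moreover have "P E c y = insert {y, z} (path_edges (xs @ [z]))"
      unfolding Py vs' by (subst path_edges_snoc) (auto simp: insert_commute)
    moreover have "y \<notin> set (xs @ [z])" using vs(1) vs' by (auto simp: simple_path_def)
    then have "{y, z} \<notin> path_edges (xs @ [z])" using path_edges_subset_set[of "{y, z}" "xs @ [z]"] by auto
    ultimately show ?thesis by auto
  qed
qed

lemma simple_path_in_V:
  assumes "simple_path E vs" "hd vs \<in> V"
  shows "set vs \<subseteq> V"
proof
  fix v assume "v \<in> set vs"
  then obtain xs ys where xy: "vs = xs @ v # ys" by (meson split_list)
  show "v \<in> V"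
  proof (cases xs rule: rev_cases)
    case Nil
    then show ?thesis using assms(2) xy by simp
  next
    case (snoc zs z)
    then have "{z, v} \<in> E"
      using path_edges_middle[of z v zs ys] assms(1) xy by (auto simp: simple_path_def)
    then show ?thesis using tree_edge[of "{z, v}"] by (metis insert_iff insertI1 singletonD)
  qed
qed

lemma P_along_path:
  assumes "simple_path E vs" "hd vs \<in> V" "c \<in> V"
  shows "f \<in> P E c (last vs) \<longleftrightarrow> (f \<in> P E c (hd vs)) \<noteq> (f \<in> path_edges vs)"
  using assms
proof (induction vs rule: rev_induct)
  case Nil
  then show ?case by (simp add: simple_path_def)
next
  case (snoc z vs)
  show ?case
  proof (cases "vs = []")
    case True
    then show ?thesis by (simp add: path_edges_simps)
  next
    case False
    have sp: "simple_path E vs" using simple_path_prefix snoc.prems(1) False by blast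
    have hd: "hd (vs @ [z]) = hd vs" using False by simp
    have e: "{last vs, z} \<in> E" and ze: "z \<notin> set vs"
      using snoc.prems(1) False by (auto simp: simple_path_def path_edges_snoc)
    have "last vs \<in> V" using simple_path_in_V[OF sp] snoc.prems(2) hd False by auto
    moreover have "last vs \<noteq> z" using ze False by auto
    ultimately have "f \<in> P E c z \<longleftrightarrow> (f \<in> P E c (last vs)) \<noteq> (f = {last vs, z})"
      using P_step[OF snoc.prems(3)] e by blast
    moreover have "{last vs, z} \<notin> path_edges vs"
      using ze path_edges_subset_set[of "{last vs, z}" vs] by auto
    ultimately show ?thesis
      using snoc.IH[OF sp] snoc.prems hd False by (auto simp: path_edges_snoc)
  qed
qed

text \<open>Walking from a to b toggles each edge of the walk once in the path from c. This is why a
  change of root complements exactly the sets of the edges between the two roots.\<close>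

lemma P_xor:
  assumes "a \<in> V" "b \<in> V" "c \<in> V"
  shows "f \<in> P E a b \<longleftrightarrow> (f \<in> P E c a) \<noteq> (f \<in> P E c b)"
proof -
  obtain vs where vs: "simple_path E vs" "hd vs = a" "last vs = b"
    using tree_path[OF assms(1,2)] by blast
  have "P E a b = path_edges vs" using vs by (rule P_eq)
  then show ?thesis using P_along_path[OF vs(1) _ assms(3), of f] vs assms by auto
qed

lemma P_self: "P E a a = {}"
proof -
  have "P E a a = path_edges [a]"
    by (rule P_eq) (auto simp: simple_path_def path_edges_simps)
  then show ?thesis by (simp add: path_edges_simps)
qed

lemma P_subset: "a \<in> V \<Longrightarrow> b \<in> V \<Longrightarrow> P E a b \<subseteq> E"
  using tree_path[of a b] P_eq by (auto simp: simple_path_def)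

text \<open>The path to an end of the edge is unique, so both paths agree up to it. Crossing the
  edge in opposite directions would make q visit a twice.\<close>

lemma simple_path_common_prefix:
  assumes "simple_path E (xs @ a # b # ys)" "simple_path E q" "hd q = hd (xs @ a # b # ys)"
    "{a, b} \<in> path_edges q"
  shows "\<exists>zs. q = xs @ a # b # zs"
proof -
  obtain xs' a' b' ys' where q: "q = xs' @ a' # b' # ys'" "{a, b} = {a', b'}"
    using assms(4) path_edges_split by metis
  have ab: "simple_path E (xs @ [a])" "simple_path E (xs @ [a, b])" "simple_path E (xs' @ [a'])"
    using simple_path_prefix[of E "xs @ [a]" "b # ys"] simple_path_prefix[of E "xs @ [a, b]" ys]
      simple_path_prefix[of E "xs' @ [a']" "b' # ys'"] assms(1,2) q(1) by auto
  have hd: "hd (xs @ [a]) = hd (xs' @ [a'])" "hd (xs @ [a, b]) = hd (xs' @ [a'])"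
    using assms(3) q(1) by (cases xs; cases xs'; simp)+
  consider "a' = a" "b' = b" | "a' = b" "b' = a" using q(2) by (auto simp: doubleton_eq_iff)
  then show ?thesis
  proof cases
    case 1
    then have "xs @ [a] = xs' @ [a']" using tree_path_unique[OF ab(1,3) hd(1)] by simp
    then show ?thesis using 1 q(1) by auto
  next
    case 2
    then have "xs @ [a, b] = xs' @ [a']" using tree_path_unique[OF ab(2,3) hd(2)] by simp
    then have "xs' = xs @ [a]" using 2 by (metis append.assoc append_Cons append_Nil butlast_snoc)
    then have "\<not> distinct q" using 2 q(1) by auto
    then show ?thesis using assms(2) by (simp add: simple_path_def)
  qed
qed

text \<open>If some v lies beyond both edges, both are on the path from the root to v. Every path
  through the later edge shares the initial segment and hence passes through the earlier
  one.\<close>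

lemma P_laminar:
  assumes "rt \<in> V" "W \<subseteq> V"
  defines "B \<equiv> \<lambda>e. {v \<in> W. e \<in> P E rt v}"
  shows "B e \<subseteq> B e' \<or> B e' \<subseteq> B e \<or> B e \<inter> B e' = {}"
proof (cases "B e \<inter> B e' = {}")
  case False
  then obtain v where v: "v \<in> W" "e \<in> P E rt v" "e' \<in> P E rt v" by (auto simp: B_def)
  have path: "\<exists>vs. simple_path E vs \<and> hd vs = rt \<and> P E rt u = path_edges vs" if "u \<in> W" for u
    using tree_path[of rt u] assms(1,2) that P_eq by blast
  obtain p where p: "simple_path E p" "hd p = rt" "P E rt v = path_edges p"
    using path[OF v(1)] by blast
  obtain xs a b ys where e: "p = xs @ a # b # ys" "e = {a, b}"
    using v(2) p(3) path_edges_split by metis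
  have "path_edges p = path_edges (xs @ [a, b]) \<union> path_edges (b # ys)"
    unfolding e using path_edges_append[of "xs @ [a]" b ys] by simp
  then consider "e' \<in> path_edges (xs @ [a, b])" | "e' \<in> path_edges (b # ys)" using v(3) p(3) by auto
  then show ?thesis
  proof cases
    case 1
    have "B e \<subseteq> B e'"
    proof
      fix u assume u: "u \<in> B e"
      then obtain q where q: "simple_path E q" "hd q = rt" "P E rt u = path_edges q"
        using path[of u] by (auto simp: B_def)
      have "{a, b} \<in> path_edges q" using u q(3) e(2) by (auto simp: B_def)
      then obtain zs where "q = xs @ a # b # zs"
        using simple_path_common_prefix[of xs a b ys q] p q e(1) by auto
      then have "path_edges q = path_edges (xs @ [a, b]) \<union> path_edges (b # zs)"
        using path_edges_append[of "xs @ [a]" b zs] by simp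
      then show "u \<in> B e'" using u 1 q(3) by (auto simp: B_def)
    qed
    then show ?thesis by blast
  next
    case 2
    then obtain xs2 a2 b2 ys2 where e': "b # ys = xs2 @ a2 # b2 # ys2" "e' = {a2, b2}"
      using path_edges_split by metis
    have pp: "p = (xs @ a # xs2) @ a2 # b2 # ys2" using e(1) e'(1) by simp
    have "B e' \<subseteq> B e"
    proof
      fix u assume u: "u \<in> B e'"
      then obtain q where q: "simple_path E q" "hd q = rt" "P E rt u = path_edges q"
        using path[of u] by (auto simp: B_def)
      have "{a2, b2} \<in> path_edges q" using u q(3) e'(2) by (auto simp: B_def)
      then obtain zs where zs: "q = (xs @ a # xs2) @ a2 # b2 # zs"
        using simple_path_common_prefix[of "xs @ a # xs2" a2 b2 ys2 q] p q pp by auto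
      obtain ts where "xs2 @ a2 # b2 # zs = b # ts" using e'(1) by (cases xs2) auto
      then have "q = xs @ a # b # ts" using zs by simp
      then have "e \<in> path_edges q" using path_edges_middle e(2) by metis
      then show "u \<in> B e" using u q(3) by (auto simp: B_def)
    qed
    then show ?thesis by blast
  qed
qed auto

text \<open>A longest path from the root through \<open>e\<close> ends in a leaf.\<close>

lemma leaf_beyond_edge:
  assumes "rt \<in> V" "e \<in> E"
  shows "\<exists>z\<in>V. Defs.degree E z = 1 \<and> e \<in> P E rt z"
proof -
  let ?Q = "\<lambda>vs. simple_path E vs \<and> hd vs = rt \<and> e \<in> path_edges vs"
  obtain a b where ab: "a \<in> V" "b \<in> V" "a \<noteq> b" "e = {a, b}" using tree_edge[OF assms(2)] by blast
  \<comment> \<open>Exactly one end of e is reached from the root through e itself.\<close>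
  have "(e \<in> P E rt b) \<noteq> (e \<in> P E rt a)" using P_step[OF assms(1) ab(1,3)] ab assms(2) by auto
  then obtain c where "c \<in> V" "e \<in> P E rt c" using ab by blast
  then obtain vs0 where "?Q vs0" using tree_path[OF assms(1), of c] P_eq by auto
  moreover have "\<forall>vs. ?Q vs \<longrightarrow> length vs \<le> card V"
  proof (intro allI impI)
    fix vs assume vs: "?Q vs"
    then have "set vs \<subseteq> V" using simple_path_in_V assms(1) by simp
    then have "card (set vs) \<le> card V" by (rule card_mono[OF tree_finite])
    then show "length vs \<le> card V" using vs by (simp add: simple_path_def distinct_card)
  qed
  ultimately have "\<exists>vs. ?Q vs \<and> (\<forall>ws. ?Q ws \<longrightarrow> length ws \<le> length vs)"
    using ex_has_greatest_nat[of ?Q vs0 length "Suc (card V)"] by (simp add: less_Suc_eq_le)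
  then obtain vs where vs: "?Q vs" and max: "\<And>ws. ?Q ws \<Longrightarrow> length ws \<le> length vs" by blast
  have sub: "set vs \<subseteq> V" using vs assms(1) simple_path_in_V[of vs] by simp
  obtain us y z where z: "vs = us @ [y, z]"
  proof -
    obtain ws z where "vs = ws @ [z]" using vs by (cases vs rule: rev_cases) (auto simp: path_edges_simps)
    moreover then obtain us y where "ws = us @ [y]"
      using vs by (cases ws rule: rev_cases) (auto simp: path_edges_simps)
    ultimately show ?thesis using that by simp
  qed
  have "{f \<in> E. z \<in> f} = {{y, z}}"
  proof (intro equalityI subsetI)
    fix f assume "f \<in> {f \<in> E. z \<in> f}"
    then have f: "f \<in> E" "z \<in> f" by auto
    then obtain x where x: "f = {z, x}" "x \<noteq> z" using tree_edge[of f] by auto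
    \<comment> \<open>A neighbour of z off the path would prolong it; one on the path can only be
      the predecessor y.\<close>
    have "x \<in> set vs"
    proof (rule ccontr)
      assume nx: "x \<notin> set vs"
      have "last vs = z" "vs \<noteq> []" using z by simp_all
      then have "?Q (vs @ [x])"
        using simple_path_snoc[of E vs x] vs nx f(1) x(1) by (simp add: path_edges_snoc)
      then show False using max by fastforce
    qed
    then obtain xs ys where xy: "vs = xs @ x # ys" by (meson split_list)
    have "last vs = z" using z by simp
    then have ys: "ys \<noteq> []" "last ys = z" using xy x(2) by (auto split: if_splits)
    have "ys = [z]"
      using tree_path_edge_last[of xs x ys] vs xy ys f(1) x(1) by (simp add: insert_commute)
    then have "xs @ [x, z] = us @ [y, z]" using xy z by simp
    then have "x = y" by simp
    then show "f \<in> {{y, z}}" using x(1) by auto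
  next
    fix f assume "f \<in> {{y, z}}"
    then show "f \<in> {f \<in> E. z \<in> f}"
      using path_edges_middle[of y z us "[]"] vs z by (auto simp: simple_path_def)
  qed
  then have "Defs.degree E z = 1" by (simp add: Defs.degree_def)
  moreover have "P E rt z = path_edges vs" using vs z by (intro P_eq) auto
  moreover have "z \<in> V" using sub z by auto
  ultimately show ?thesis using vs by auto
qed

end

section \<open>From trees to laminar families\<close>

definition finfuns :: "'e set \<Rightarrow> nat \<Rightarrow> ('e \<Rightarrow> nat) set" where
  "finfuns S n = {l. (\<forall>e. e \<notin> S \<longrightarrow> l e = 0) \<and> sum l S = n}"

lemma finite_finfuns:
  assumes "finite S"
  shows "finite (finfuns S n)"
proof (rule finite_subset)
  show "finfuns S n \<subseteq> {l. \<forall>e. (e \<in> S \<longrightarrow> l e \<in> {..n}) \<and> (e \<notin> S \<longrightarrow> l e = 0)}"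
  proof
    fix l assume l: "l \<in> finfuns S n"
    have "l e \<le> n" if "e \<in> S" for e
      using member_le_sum[OF that, of l] assms l by (auto simp: finfuns_def)
    then show "l \<in> {l. \<forall>e. (e \<in> S \<longrightarrow> l e \<in> {..n}) \<and> (e \<notin> S \<longrightarrow> l e = 0)}"
      using l by (auto simp: finfuns_def)
  qed
qed (intro finite_set_of_finite_funs assms finite_atMost)

lemma fps_prod_nth_finfuns:
  fixes f :: "'e \<Rightarrow> rat fps"
  assumes "finite S"
  shows "(\<Prod>e\<in>S. f e) $ n = (\<Sum>l\<in>finfuns S n. \<Prod>e\<in>S. f e $ l e)"
  using assms
proof (induction S arbitrary: n rule: finite_induct)
  case empty
  have "finfuns ({} :: 'e set) n = (if n = 0 then {\<lambda>_. 0} else {})"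
    by (auto simp: finfuns_def)
  then show ?case by (simp add: fps_one_nth)
next
  case (insert x S)
  let ?S = "SIGMA i:{0..n}. finfuns S (n - i)"
  have "(\<Prod>e\<in>insert x S. f e) $ n = (\<Sum>i=0..n. \<Sum>l\<in>finfuns S (n - i). f x $ i * (\<Prod>e\<in>S. f e $ l e))"
    using insert by (simp add: fps_mult_nth sum_distrib_left)
  also have "\<dots> = (\<Sum>(i, l)\<in>?S. f x $ i * (\<Prod>e\<in>S. f e $ l e))"
    by (subst sum.Sigma) (auto simp: finite_finfuns insert.hyps)
  also have "\<dots> = (\<Sum>l\<in>finfuns (insert x S) n. \<Prod>e\<in>insert x S. f e $ l e)"
  proof (rule sum.reindex_bij_witness[of _ "\<lambda>l. (l x, l(x := 0))" "\<lambda>(i, l). l(x := i)"])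
    have upd: "(\<Sum>e\<in>S. if e = x then i else l e) = sum l S" for l :: "'e \<Rightarrow> nat" and i
      using insert.hyps by (intro sum.cong) auto
    fix p assume p: "p \<in> ?S"
    obtain i l where il: "p = (i, l)" by (cases p)
    have l: "l x = 0" "i \<le> n" "sum l S = n - i" "\<And>e. e \<notin> S \<Longrightarrow> l e = 0"
      using p il insert.hyps by (auto simp: finfuns_def)
    show "(((case p of (i, l) \<Rightarrow> l(x := i)) x, (case p of (i, l) \<Rightarrow> l(x := i))(x := 0))) = p"
      using il l by auto
    show "(case p of (i, l) \<Rightarrow> l(x := i)) \<in> finfuns (insert x S) n"
      using il l insert.hyps by (simp add: finfuns_def upd)
    have "(\<Prod>e\<in>S. f e $ (l(x := i)) e) = (\<Prod>e\<in>S. f e $ l e)"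
      using insert.hyps by (intro prod.cong) auto
    then show "(\<Prod>e\<in>insert x S. f e $ (case p of (i, l) \<Rightarrow> l(x := i)) e)
      = (case p of (i, l) \<Rightarrow> f x $ i * (\<Prod>e\<in>S. f e $ l e))"
      using il insert.hyps by simp
  next
    have upd: "(\<Sum>e\<in>S. if e = x then i else l e) = sum l S" for l :: "'e \<Rightarrow> nat" and i
      using insert.hyps by (intro sum.cong) auto
    fix l assume l: "l \<in> finfuns (insert x S) n"
    show "(case (l x, l(x := 0)) of (i, l) \<Rightarrow> l(x := i)) = l" by simp
    show "(l x, l(x := 0)) \<in> ?S"
      using l insert.hyps by (auto simp: finfuns_def upd)
  qed
  finally show ?case .
qed

definition below :: "'v set set \<Rightarrow> 'v \<Rightarrow> 'v set \<Rightarrow> 'v set \<Rightarrow> 'v set" where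
  "below E rt Vb e = {v \<in> Vb. e \<in> P E rt v}"

text \<open>Edges with exponent 0 disappear, and exponents of edges with the same set add up. This
  reproduces the contracting and joining of edges in the harvestable form.\<close>

definition edge_mset :: "'v set set \<Rightarrow> 'v \<Rightarrow> 'v set \<Rightarrow> ('v set \<Rightarrow> nat) \<Rightarrow> 'v set multiset" where
  "edge_mset E rt Vb k = (\<Sum>e\<in>E. replicate_mset (k e) (below E rt Vb e))"

lemma in_edge_mset:
  assumes "finite E"
  shows "B \<in># edge_mset E rt Vb k \<longleftrightarrow> (\<exists>e\<in>E. 0 < k e \<and> B = below E rt Vb e)"
proof -
  have "B \<in># (\<Sum>e\<in>F. replicate_mset (k e) (below E rt Vb e)) \<longleftrightarrow> (\<exists>e\<in>F. 0 < k e \<and> B = below E rt Vb e)"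
    if "finite F" for F
    using that by (induction F rule: finite_induct) auto
  then show ?thesis using assms by (simp add: edge_mset_def)
qed

text \<open>Members are nonempty because a leaf, which is black, lies beyond each edge. An edge of
  positive exponent between two black vertices is on exactly one of their paths from the root, so
  its set separates them.\<close>

lemma edge_mset_separating_laminar:
  assumes T: "two_colored_rooted_tree V E rt Vb" and rt: "rt \<in> Vb" and k: "ess_pos E Vb k"
  shows "separating_laminar Vb rt (edge_mset E rt Vb k)"
proof -
  have tree: "is_tree V E" and rtV: "rt \<in> V" and VbV: "Vb \<subseteq> V"
    and leaf: "\<And>v. v \<in> V \<Longrightarrow> Defs.degree E v = 1 \<Longrightarrow> v \<in> Vb"
    using T by (auto simp: two_colored_rooted_tree_def)
  note mem = in_edge_mset[OF tree_finite_edges[OF tree]]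
  show ?thesis
    unfolding separating_laminar_def
  proof (intro conjI ballI impI)
    show "finite Vb" using VbV tree_finite[OF tree] finite_subset by blast
    show "rt \<in> Vb" by fact
  next
    fix B assume "B \<in># edge_mset E rt Vb k"
    then obtain e where e: "e \<in> E" "B = below E rt Vb e" by (auto simp: mem)
    show "B \<subseteq> Vb" using e by (auto simp: below_def)
    show "B \<noteq> {}" using e leaf leaf_beyond_edge[OF tree rtV e(1)] by (auto simp: below_def)
    show "rt \<notin> B" using e P_self[OF tree] by (auto simp: below_def)
  next
    fix A B assume "A \<in># edge_mset E rt Vb k" "B \<in># edge_mset E rt Vb k"
    then obtain e e' where "A = below E rt Vb e" "B = below E rt Vb e'" by (auto simp: mem)
    then show "A \<subseteq> B \<or> B \<subseteq> A \<or> A \<inter> B = {}"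
      using P_laminar[OF tree rtV VbV, of e e'] by (simp add: below_def)
  next
    fix v v' assume v: "v \<in> Vb" "v' \<in> Vb" "v \<noteq> v'"
    then have "0 < sum k (P E v v')" using k by (auto simp: ess_pos_def)
    then obtain e where e: "e \<in> P E v v'" "0 < k e"
      by (metis gr0I less_irrefl sum.neutral)
    have vV: "v \<in> V" "v' \<in> V" using v VbV by auto
    have "e \<in> E" using e P_subset[OF tree vV] by auto
    moreover have "(e \<in> P E rt v) \<noteq> (e \<in> P E rt v')"
      using P_xor[OF tree vV rtV] e by blast
    ultimately show "\<exists>B\<in>#edge_mset E rt Vb k. (v \<in> B) \<noteq> (v' \<in> B)"
      using e v by (intro bexI[of _ "below E rt Vb e"]) (auto simp: mem below_def)
  qed
qed

text \<open>By \<open>P_xor\<close> the sets seen from v are the complements exactly for edges on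
  the path from rt to v. These edges give powers of t minus a weight, whose expansion supplies sign,
  binomials and shifted exponents.\<close>

lemma laminar_series_edge_mset_nth:
  assumes T: "two_colored_rooted_tree V E rt Vb" and rt: "rt \<in> Vb" and v: "v \<in> Vb"
  shows "laminar_series Vb M v (edge_mset E rt Vb k) $ n =
    (-1) ^ (sum k (P E rt v)) * (\<Sum>l\<in>finfuns (P E rt v) n.
       of_nat (\<Prod>e\<in>P E rt v. bin (k e) (l e)) * zeta M V E v Vb (\<lambda>e. k e + l e))"
proof -
  have tree: "is_tree V E" and rtV: "rt \<in> V" and VbV: "Vb \<subseteq> V"
    using T by (auto simp: two_colored_rooted_tree_def)
  let ?P = "P E rt v" and ?B = "below E rt Vb"
  have finE: "finite E" by (rule tree_finite_edges[OF tree])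
  have PE: "?P \<subseteq> E" using P_subset[OF tree rtV] v VbV by blast
  then have finP: "finite ?P" using finE finite_subset by blast
  have finVb: "finite Vb" using VbV tree_finite[OF tree] finite_subset by blast
  have vB: "v \<in> ?B e \<longleftrightarrow> e \<in> ?P" for e using v by (simp add: below_def)
  have Bv: "{u \<in> Vb. e \<in> P E v u} = (if e \<in> ?P then Vb - ?B e else ?B e)" for e
    using P_xor[OF tree _ _ rtV, of v _ e] v VbV by (auto simp: below_def subset_iff)
  have summand: "(\<Prod>e\<in>E. inverse (side Vb v m (?B e)) ^ k e) $ n
      = (\<Sum>l\<in>finfuns ?P n. (-1) ^ sum k ?P * of_nat (\<Prod>e\<in>?P. bin (k e) (l e))
          * (\<Prod>e\<in>E. inv_pow (k e + l e) (\<Sum>u\<in>{u\<in>Vb. e \<in> P E v u}. m u)))"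
    if m: "m \<in> wts Vb M" for m
  proof -
    define c where "c = (\<Prod>e\<in>E - ?P. inv_pow (k e) (sum m (?B e)))"
    have N: "1 \<le> sum m (Vb - ?B e)" for e
    proof -
      have "rt \<in> Vb - ?B e" using rt P_self[OF tree] by (auto simp: below_def)
      then have "m rt \<le> sum m (Vb - ?B e)" using finVb by (intro member_le_sum) auto
      moreover have "1 \<le> m rt" using m rt by (auto simp: wts_def)
      ultimately show ?thesis by simp
    qed
    have "(\<Prod>e\<in>E. inverse (side Vb v m (?B e)) ^ k e)
      = (\<Prod>e\<in>E - ?P. inverse (side Vb v m (?B e)) ^ k e) * (\<Prod>e\<in>?P. inverse (side Vb v m (?B e)) ^ k e)"
      by (rule prod.subset_diff[OF PE finE])
    also have "(\<Prod>e\<in>E - ?P. inverse (side Vb v m (?B e)) ^ k e) = (\<Prod>e\<in>E - ?P. fps_const (inv_pow (k e) (sum m (?B e))))"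
      by (rule prod.cong) (auto simp: side_def vB fps_const_inverse inverse_eq_divide)
    also have "\<dots> = fps_const c"
    proof -
      have "(\<Prod>x\<in>A. fps_const (f x)) = fps_const (prod f A)" for f :: "'a set \<Rightarrow> rat" and A
        by (induction A rule: infinite_finite_induct) auto
      then show ?thesis by (simp add: c_def)
    qed
    also have "(\<Prod>e\<in>?P. inverse (side Vb v m (?B e)) ^ k e) = (\<Prod>e\<in>?P. shift_pow (k e) (sum m (Vb - ?B e)))"
      by (rule prod.cong) (auto simp: side_def vB shift_pow_def)
    finally have "(\<Prod>e\<in>E. inverse (side Vb v m (?B e)) ^ k e) $ n
        = c * (\<Sum>l\<in>finfuns ?P n. \<Prod>e\<in>?P. shift_pow (k e) (sum m (Vb - ?B e)) $ l e)"
      by (simp add: fps_prod_nth_finfuns[OF finP])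
    also have "\<dots> = (\<Sum>l\<in>finfuns ?P n. (-1) ^ sum k ?P * of_nat (\<Prod>e\<in>?P. bin (k e) (l e))
          * (c * (\<Prod>e\<in>?P. inv_pow (k e + l e) (sum m (Vb - ?B e)))))"
      unfolding sum_distrib_left shift_pow_nth[OF N] prod.distrib power_sum[symmetric] of_nat_prod
      by (simp add: ac_simps)
    also have "\<dots> = (\<Sum>l\<in>finfuns ?P n. (-1) ^ sum k ?P * of_nat (\<Prod>e\<in>?P. bin (k e) (l e))
          * (\<Prod>e\<in>E. inv_pow (k e + l e) (\<Sum>u\<in>{u\<in>Vb. e \<in> P E v u}. m u)))"
    proof (rule sum.cong[OF refl])
      fix l assume l: "l \<in> finfuns ?P n"
      have "(\<Prod>e\<in>E. inv_pow (k e + l e) (\<Sum>u\<in>{u\<in>Vb. e \<in> P E v u}. m u))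
        = (\<Prod>e\<in>E - ?P. inv_pow (k e + l e) (\<Sum>u\<in>{u\<in>Vb. e \<in> P E v u}. m u))
          * (\<Prod>e\<in>?P. inv_pow (k e + l e) (\<Sum>u\<in>{u\<in>Vb. e \<in> P E v u}. m u))"
        by (rule prod.subset_diff[OF PE finE])
      \<comment> \<open>Off the path l vanishes, so the exponent is still
        \<open>k e\<close>.\<close>
      also have "(\<Prod>e\<in>E - ?P. inv_pow (k e + l e) (\<Sum>u\<in>{u\<in>Vb. e \<in> P E v u}. m u)) = c"
        unfolding c_def by (rule prod.cong) (use l in \<open>auto simp: Bv finfuns_def\<close>)
      also have "(\<Prod>e\<in>?P. inv_pow (k e + l e) (\<Sum>u\<in>{u\<in>Vb. e \<in> P E v u}. m u))
        = (\<Prod>e\<in>?P. inv_pow (k e + l e) (sum m (Vb - ?B e)))"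
        by (rule prod.cong) (auto simp: Bv)
      finally show "(-1) ^ sum k ?P * of_nat (\<Prod>e\<in>?P. bin (k e) (l e)) * (c * (\<Prod>e\<in>?P. inv_pow (k e + l e) (sum m (Vb - ?B e))))
        = (-1) ^ sum k ?P * of_nat (\<Prod>e\<in>?P. bin (k e) (l e))
          * (\<Prod>e\<in>E. inv_pow (k e + l e) (\<Sum>u\<in>{u\<in>Vb. e \<in> P E v u}. m u))" by simp
    qed
    finally show ?thesis .
  qed
  have "laminar_series Vb M v (edge_mset E rt Vb k) $ n
      = (\<Sum>m\<in>wts Vb M. (\<Prod>e\<in>E. inverse (side Vb v m (?B e)) ^ k e) $ n)"
    by (simp add: laminar_series_def edge_mset_def prod_mset_sum_replicate fps_sum_nth)
  also have "\<dots> = (\<Sum>m\<in>wts Vb M. \<Sum>l\<in>finfuns ?P n. (-1) ^ sum k ?P * of_nat (\<Prod>e\<in>?P. bin (k e) (l e))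
          * (\<Prod>e\<in>E. inv_pow (k e + l e) (\<Sum>u\<in>{u\<in>Vb. e \<in> P E v u}. m u)))"
    by (rule sum.cong[OF refl summand])
  also have "\<dots> = (\<Sum>l\<in>finfuns ?P n. (-1) ^ sum k ?P * of_nat (\<Prod>e\<in>?P. bin (k e) (l e))
          * (\<Sum>m\<in>wts Vb M. \<Prod>e\<in>E. inv_pow (k e + l e) (\<Sum>u\<in>{u\<in>Vb. e \<in> P E v u}. m u)))"
    unfolding sum_distrib_left by (rule sum.swap)
  finally show ?thesis
    unfolding sum_distrib_left mult.assoc zeta_def wts_def .
qed

lemma finfuns_empty_0: "finfuns {} 0 = {\<lambda>_. 0}"
  by (auto simp: finfuns_def)

text \<open>The description by \<open>THE\<close> is resolved here: \<open>realizable\<close>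
  provides the element and \<open>Zmap_inject\<close> its uniqueness.\<close>

lemma wtree_realizes:
  assumes T: "two_colored_rooted_tree V E rt Vb" and rt: "rt \<in> Vb" and k: "ess_pos E Vb k"
  shows "in_H1 (wtree V E rt Vb k)"
    and "M \<ge> 1 \<Longrightarrow> Zmap M (wtree V E rt Vb k) = zeta M V E rt Vb k"
    and "M \<ge> 1 \<Longrightarrow> Zmap M (phihat (wtree V E rt Vb k) n)
      = (\<Sum>v\<in>Vb. laminar_series Vb M v (edge_mset E rt Vb k) $ n)"
proof -
  have tree: "is_tree V E" using T by (simp add: two_colored_rooted_tree_def)
  have "realizable Vb rt (edge_mset E rt Vb k)"
    by (rule separating_laminar_realizable[OF edge_mset_separating_laminar[OF assms]])
  then obtain w where w: "in_H1 w" and w0: "\<And>M. M \<ge> 1 \<Longrightarrow> Zmap M w = laminar_series Vb M rt (edge_mset E rt Vb k) $ 0"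
    and wn: "\<And>M n. M \<ge> 1 \<Longrightarrow> Zmap M (phihat w n) = (\<Sum>v\<in>Vb. laminar_series Vb M v (edge_mset E rt Vb k) $ n)"
    unfolding realizable_def by blast
  \<comment> \<open>For v = rt the path is empty, so nothing is complemented and the constant term
    is zeta_M itself.\<close>
  have z: "Zmap M w = zeta M V E rt Vb k" if "M \<ge> 1" for M
    using w0[OF that] by (simp add: laminar_series_edge_mset_nth[OF T rt rt] P_self[OF tree] finfuns_empty_0)
  have "wtree V E rt Vb k = w"
    unfolding wtree_def
  proof (rule the_equality)
    fix w' assume "in_H1 w' \<and> (\<forall>M\<ge>1. Zmap M w' = zeta M V E rt Vb k)"
    then show "w' = w" using w z by (intro Zmap_inject) auto
  qed (use w z in auto)
  then show "in_H1 (wtree V E rt Vb k)" "M \<ge> 1 \<Longrightarrow> Zmap M (wtree V E rt Vb k) = zeta M V E rt Vb k"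
    "M \<ge> 1 \<Longrightarrow> Zmap M (phihat (wtree V E rt Vb k) n)
      = (\<Sum>v\<in>Vb. laminar_series Vb M v (edge_mset E rt Vb k) $ n)"
    using w z wn by simp_all
qed

text \<open>Both sides lie in H1 and are compared through Z_M. Essential positivity does not depend
  on the root and persists under k + l, so every tree on the right is covered by
  \<open>wtree_realizes\<close>.\<close>

lemma phihat_wtree:
  assumes T: "two_colored_rooted_tree V E rt Vb" and rt: "rt \<in> Vb" and k: "ess_pos E Vb k"
  shows "phihat (wtree V E rt Vb k) n = (\<lambda>u. \<Sum>v\<in>Vb. (-1) ^ (sum k (P E rt v)) *
    (\<Sum>l\<in>finfuns (P E rt v) n. of_nat (\<Prod>e\<in>P E rt v. bin (k e) (l e)) * wtree V E v Vb (\<lambda>e. k e + l e) u))"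
proof (rule Zmap_inject)
  have Tv: "two_colored_rooted_tree V E v Vb" if "v \<in> Vb" for v
    using T that by (auto simp: two_colored_rooted_tree_def)
  have kl: "ess_pos E Vb (\<lambda>e. k e + l e)" for l
    using k by (auto simp: ess_pos_def sum.distrib)
  have H1: "in_H1 (wtree V E v Vb (\<lambda>e. k e + l e))" if "v \<in> Vb" for v l
    using wtree_realizes(1)[OF Tv[OF that] that kl] .
  show "in_H1 (phihat (wtree V E rt Vb k) n)"
    by (intro in_H1_phihat wtree_realizes(1) assms)
  show "in_H1 (\<lambda>u. \<Sum>v\<in>Vb. (-1) ^ (sum k (P E rt v)) *
    (\<Sum>l\<in>finfuns (P E rt v) n. of_nat (\<Prod>e\<in>P E rt v. bin (k e) (l e)) * wtree V E v Vb (\<lambda>e. k e + l e) u))"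
    by (intro in_H1_sum in_H1_scale H1)
  fix M :: nat assume M: "M \<ge> 1"
  have "Zmap M (\<lambda>u. \<Sum>v\<in>Vb. (-1) ^ (sum k (P E rt v)) *
      (\<Sum>l\<in>finfuns (P E rt v) n. of_nat (\<Prod>e\<in>P E rt v. bin (k e) (l e)) * wtree V E v Vb (\<lambda>e. k e + l e) u))
    = (\<Sum>v\<in>Vb. Zmap M (\<lambda>u. (-1) ^ (sum k (P E rt v)) *
      (\<Sum>l\<in>finfuns (P E rt v) n. of_nat (\<Prod>e\<in>P E rt v. bin (k e) (l e)) * wtree V E v Vb (\<lambda>e. k e + l e) u)))"
    by (intro Zmap_sum in_H1_sum in_H1_scale H1 M)
  also have "\<dots> = (\<Sum>v\<in>Vb. laminar_series Vb M v (edge_mset E rt Vb k) $ n)"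
  proof (rule sum.cong[OF refl])
    fix v assume v: "v \<in> Vb"
    have H: "in_H1 (\<lambda>u. of_nat (\<Prod>e\<in>P E rt v. bin (k e) (l e)) * wtree V E v Vb (\<lambda>e. k e + l e) u)" for l
      by (intro in_H1_scale H1 v)
    show "Zmap M (\<lambda>u. (-1) ^ (sum k (P E rt v)) *
      (\<Sum>l\<in>finfuns (P E rt v) n. of_nat (\<Prod>e\<in>P E rt v. bin (k e) (l e)) * wtree V E v Vb (\<lambda>e. k e + l e) u))
      = laminar_series Vb M v (edge_mset E rt Vb k) $ n"
      unfolding laminar_series_edge_mset_nth[OF T rt v] Zmap_scale[OF in_H1_sum[OF H] M] Zmap_sum[OF H M]
        Zmap_scale[OF H1[OF v] M] wtree_realizes(2)[OF Tv[OF v] v kl M] ..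
  qed
  finally show "Zmap M (phihat (wtree V E rt Vb k) n) = Zmap M (\<lambda>u. \<Sum>v\<in>Vb. (-1) ^ (sum k (P E rt v)) *
    (\<Sum>l\<in>finfuns (P E rt v) n. of_nat (\<Prod>e\<in>P E rt v. bin (k e) (l e)) * wtree V E v Vb (\<lambda>e. k e + l e) u))"
    using wtree_realizes(3)[OF T rt k M] by simp
qed

theorem theorem1p2:
  fixes V :: "'v set" and E :: "'v set set" and rt :: 'v and Vb :: "'v set"
    and k :: "'v set \<Rightarrow> nat"
  assumes "two_colored_rooted_tree V E rt Vb"
    and "rt \<in> Vb"
    and "ess_pos E Vb k"
  shows "(\<forall>n u. phihat (wtree V E rt Vb k) n u =
            (\<Sum>v\<in>Vb. (-1) ^ (sum k (P E rt v)) *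
               (\<Sum>l\<in>{l. (\<forall>e. e \<notin> P E rt v \<longrightarrow> l e = 0) \<and> sum l (P E rt v) = n}.
                  of_nat (\<Prod>e\<in>P E rt v. bin (k e) (l e)) * wtree V E v Vb (\<lambda>e. k e + l e) u)))
       \<and> (\<forall>u. phi (wtree V E rt Vb k) u =
            (\<Sum>v\<in>Vb. (-1) ^ (sum k (P E rt v)) * wtree V E v Vb k u))"
proof (intro conjI allI)
  fix n u
  show "phihat (wtree V E rt Vb k) n u =
            (\<Sum>v\<in>Vb. (-1) ^ (sum k (P E rt v)) *
               (\<Sum>l\<in>{l. (\<forall>e. e \<notin> P E rt v \<longrightarrow> l e = 0) \<and> sum l (P E rt v) = n}.
                  of_nat (\<Prod>e\<in>P E rt v. bin (k e) (l e)) * wtree V E v Vb (\<lambda>e. k e + l e) u))"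
    unfolding phihat_wtree[OF assms] finfuns_def ..
next
  fix u
  \<comment> \<open>At t = 0 only l = 0 remains, and its binomial factors are 1.\<close>
  have "finfuns (P E rt v) 0 = {\<lambda>_. 0}" if "v \<in> Vb" for v
  proof -
    have tree: "is_tree V E" and "rt \<in> V" "v \<in> V"
      using assms(1) that by (auto simp: two_colored_rooted_tree_def)
    then have "finite (P E rt v)"
      using P_subset[OF tree] tree_finite_edges[OF tree] finite_subset by metis
    then show ?thesis by (auto simp: finfuns_def)
  qed
  moreover have "bin j 0 = 1" for j by (simp add: bin_def)
  ultimately show "phi (wtree V E rt Vb k) u = (\<Sum>v\<in>Vb. (-1) ^ (sum k (P E rt v)) * wtree V E v Vb k u)"
    unfolding phi_def phihat_wtree[OF assms] by simp
qed

end
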